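(* Suppose that the Taylor complex $\tilde K$ of $\mathcal A$ is a resolution of $S/I$. Then the complex $\tilde M$ coincides with the Scarf complex (in particular the latter is acyclic) if and only if for every $Q\in D$ either $|\mathcal B(Q)|=1$ or the complex $K(Q)$ is exact.
   Context: Let $k$ be a field, $S=k[x_1,\dots,x_n]$, and let $\mathcal A=\{Q_1,\dots,Q_m\}\subset S$ be a finite set of nonconstant homogeneous polynomials, linearly ordered by index, minimally generating an ideal $I$. Least common multiples are normalized to be products of fixed representatives of the irreducible factors of the $Q_i$. For $\sigma\subset\mathcal A$ let $Q_\sigma$ be the least common multiple of the elements of $\sigma$, $Q_\emptyset=1$. Let $D=\{Q_\sigma:\sigma\subset\mathcal A\}$, a lattice under divisibility. $K$: $K_p$ is the $k$-space with basis $\{\sigma\subset\mathcal A:|\sigma|=p\}$, with $d(\tau)=\sum_{Q_i\in\tau}(-1)^{\epsilon(\tau,i)}\tau\setminus\{Q_i\}$, $\epsilon(\tau,i)=|\{Q_j\in\tau:j<i\}|$. Taylor complex: $\tilde K_p=K_p\otimes_k S$ with $\tilde d(\tau)=\sum_{Q_i\in\tau}(-1)^{\epsilon(\tau,i)}\frac{Q_\tau}{Q_{\tau\setminus\{Q_i\}}}\,\tau\setminus\{Q_i\}$; $H_0(\tilde K)=S/I$. For $Q\in D$ let $\mathcal B(Q)=\{\sigma\subset\mathcal A:Q_\sigma=Q\}$ and let $K(Q)\subset K$ be the graded subspace spanned by $\mathcal B(Q)$, so $K=\bigoplus_{Q\in D}K(Q)$ as graded spaces; let $\pi_Q:K\to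 K(Q)$ be the projection. $K(Q)$ is a complex with differential $d(Q)=\pi_Q d|_{K(Q)}$. Let $Z(Q)_p,B(Q)_p\subset K(Q)_p$ be its cycles and boundaries. Fix (arbitrary) decompositions $K(Q)_p=B(Q)_p\oplus H'(Q)_p\oplus B'(Q)_{p-1}$ with $B(Q)_p\oplus H'(Q)_p=Z(Q)_p$; thus $B'(Q)_{p-1}\subset K(Q)_p$ and $d(Q)$ restricts to an isomorphism $B'(Q)_{p-1}\to B(Q)_{p-1}$, while $H'(Q)_p$ maps isomorphically to $H_p(K(Q))$. Put $H'=\bigoplus_Q H'(Q)$, $B'=\bigoplus_Q B'(Q)$. For each $a\in H'_p=\bigoplus_QH'(Q)_p$ there is a unique $f(a)\in\bigoplus_P B'(P)_{p-1}\subset K_p$ with $d(a+f(a))\in H'\oplus B'$; this defines a linear map $f:H'\to B'$, and $f(a)\in\bigoplus_{P<Q}B'(P)$ if $a\in H'(Q)$ (with $<$ proper divisibility). For $a\in H'(Q)$ write $f(a)=\sum_{P<Q}f(a)_P$ with $f(a)_P\in B'(P)$ and set $\tilde a=a+\sum_{P<Q}\frac{Q}{P}f(a)_P\in\tilde K$. $\tilde M$ is the graded $S$-submodule of $\tilde K$ generated by all $\tilde a$, $a\in H'(Q)$, $Q\in D$, with the restriction of $\tilde d$. The Scarf complex is the subcomplex of $\tilde K$ generated as an $S$-module by the $\sigma\subset\mathcal A$ such that $|\mathcal B(Q_\sigma)|=1$. "Acyclic" means having zero homology in positive degrees. *)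

theory Defs
  imports Complex_Main "HOL-Library.Poly_Mapping" "HOL-Computational_Algebra.Factorial_Ring"
begin

section \<open>The polynomial ring\<close>

text \<open>The ring S = k[x_1,...,x_n] is the type below with \<^typ>\<open>'x\<close> finite and linearly ordered (the
  variables, so n = CARD('x)); a monomial is its exponent vector and a polynomial maps monomials
  to coefficients.\<close>

type_synonym ('x, 'k) mpoly = "('x \<Rightarrow>\<^sub>0 nat) \<Rightarrow>\<^sub>0 'k"

definition const_poly :: "'k::zero \<Rightarrow> ('x, 'k) mpoly" where
  "const_poly c = Poly_Mapping.single 0 c"

definition total_degree :: "('x::finite \<Rightarrow>\<^sub>0 nat) \<Rightarrow> nat" where
  "total_degree u = (\<Sum>x\<in>UNIV. Poly_Mapping.lookup u x)"

definition homogeneous :: "('x::finite, 'k::zero) mpoly \<Rightarrow> bool" where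
  "homogeneous q \<longleftrightarrow> (\<exists>e. \<forall>u\<in>Poly_Mapping.keys q. total_degree u = e)"

definition gen_ideal :: "'r::comm_ring_1 set \<Rightarrow> 'r set" where
  "gen_ideal A = module.span (*) A"

definition minimally_generates :: "'r::comm_ring_1 set \<Rightarrow> 'r set \<Rightarrow> bool" where
  "minimally_generates A I \<longleftrightarrow> gen_ideal A = I \<and> (\<forall>B. B \<subset> A \<longrightarrow> gen_ideal B \<noteq> I)"

text \<open>The quotient b/a of a by a divisor; only used when b divides a in an integral domain.\<close>

definition quot :: "'r::comm_ring_1 \<Rightarrow> 'r \<Rightarrow> 'r" where
  "quot a b = (THE c. a = b * c)"

definition proper_dvd :: "'r::comm_ring_1 \<Rightarrow> 'r \<Rightarrow> bool" where
  "proper_dvd a b \<longleftrightarrow> a dvd b \<and> \<not> b dvd a"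

definition irreducible_factor_reps :: "'r::comm_ring_1 set \<Rightarrow> 'r set \<Rightarrow> bool" where
  "irreducible_factor_reps A R \<longleftrightarrow>
     (\<forall>r\<in>R. irreducible r \<and> (\<exists>a\<in>A. r dvd a)) \<and>
     (\<forall>p. irreducible p \<and> (\<exists>a\<in>A. p dvd a) \<longrightarrow> (\<exists>!r. r \<in> R \<and> r dvd p \<and> p dvd r))"

definition normalized_lcm :: "'r::comm_ring_1 set \<Rightarrow> 'r set \<Rightarrow> 'r \<Rightarrow> bool" where
  "normalized_lcm R X q \<longleftrightarrow>
     (\<forall>a\<in>X. a dvd q) \<and> (\<forall>s. (\<forall>a\<in>X. a dvd s) \<longrightarrow> q dvd s) \<and>
     (\<exists>F. set_mset F \<subseteq> R \<and> q = prod_mset F)"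


section \<open>Free modules on the subsets of A, and the two differentials\<close>

text \<open>The subset {Q_i | i in s} of A is represented by its index set s, a subset of {1..m}.
  The type \<^typ>\<open>nat set \<Rightarrow>\<^sub>0 'r\<close> is the free module on all sets of naturals, and
  \<open>chains m p\<close> is its part spanned by the p-element subsets of {1..m}: this is K_p for the
  coefficient ring k, and the term of degree p of the Taylor complex for the coefficient ring S.\<close>

definition smul :: "'r::comm_ring_1 \<Rightarrow> ('b \<Rightarrow>\<^sub>0 'r) \<Rightarrow> ('b \<Rightarrow>\<^sub>0 'r)" where
  "smul r c = Poly_Mapping.map ((*) r) c"

lemma lookup_smul: "Poly_Mapping.lookup (smul r c) s = r * Poly_Mapping.lookup c s"
  unfolding smul_def by (simp add: Poly_Mapping.map.rep_eq when_def)

lemma module_smul: "module smul"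
  by unfold_locales
    (auto intro!: poly_mapping_eqI simp: lookup_smul lookup_add algebra_simps)

lemma module_times: "module ((*) :: 'r::comm_ring_1 \<Rightarrow> 'r \<Rightarrow> 'r)"
  by unfold_locales (auto simp: algebra_simps)

definition chains :: "nat \<Rightarrow> nat \<Rightarrow> (nat set \<Rightarrow>\<^sub>0 'r::comm_ring_1) set" where
  "chains m p = {c. Poly_Mapping.keys c \<subseteq> {s. s \<subseteq> {1..m} \<and> card s = p}}"

definition eps :: "nat set \<Rightarrow> nat \<Rightarrow> nat" where
  "eps t i = card {j\<in>t. j < i}"

definition diff_basis :: "nat set \<Rightarrow> (nat set \<Rightarrow>\<^sub>0 'k::comm_ring_1)" where
  "diff_basis t = (\<Sum>i\<in>t. Poly_Mapping.single (t - {i}) ((-1) ^ eps t i))"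

definition diff :: "(nat set \<Rightarrow>\<^sub>0 'k::comm_ring_1) \<Rightarrow> (nat set \<Rightarrow>\<^sub>0 'k)" where
  "diff c = (\<Sum>t\<in>Poly_Mapping.keys c. smul (Poly_Mapping.lookup c t) (diff_basis t))"

text \<open>In all that follows \<open>L s\<close> plays the role of Q_s, the least common multiple.\<close>

definition taylor_diff_basis :: "(nat set \<Rightarrow> 'r) \<Rightarrow> nat set \<Rightarrow> (nat set \<Rightarrow>\<^sub>0 'r::comm_ring_1)" where
  "taylor_diff_basis L t =
     (\<Sum>i\<in>t. Poly_Mapping.single (t - {i}) ((-1) ^ eps t i * quot (L t) (L (t - {i}))))"

definition taylor_diff ::
  "(nat set \<Rightarrow> 'r) \<Rightarrow> (nat set \<Rightarrow>\<^sub>0 'r::comm_ring_1) \<Rightarrow> (nat set \<Rightarrow>\<^sub>0 'r)" where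
  "taylor_diff L c =
     (\<Sum>t\<in>Poly_Mapping.keys c. smul (Poly_Mapping.lookup c t) (taylor_diff_basis L t))"

text \<open>Vanishing homology in positive degrees of a graded submodule \<open>N\<close> of the Taylor complex,
  with the restricted differential.\<close>

definition acyclic_subcomplex ::
  "nat \<Rightarrow> (nat set \<Rightarrow> 'r) \<Rightarrow> (nat set \<Rightarrow>\<^sub>0 'r::comm_ring_1) set \<Rightarrow> bool" where
  "acyclic_subcomplex m L N \<longleftrightarrow>
     (\<forall>p\<ge>1. {c \<in> N \<inter> chains m p. taylor_diff L c = 0}
            = taylor_diff L ` (N \<inter> chains m (p + 1)))"

text \<open>Exactness of the Taylor complex augmented by the projection of its degree 0 part, which is
  free on the empty set, onto S/I. The second conjunct is exactness in degree 0.\<close>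

definition taylor_is_resolution ::
  "nat \<Rightarrow> (nat set \<Rightarrow> 'r) \<Rightarrow> 'r::comm_ring_1 set \<Rightarrow> bool" where
  "taylor_is_resolution m L I \<longleftrightarrow>
     acyclic_subcomplex m L UNIV \<and>
     {c \<in> chains m 0. Poly_Mapping.lookup c {} \<in> I} = taylor_diff L ` chains m 1"


section \<open>The complexes K(Q)\<close>

definition lcm_lattice :: "nat \<Rightarrow> (nat set \<Rightarrow> 'r) \<Rightarrow> 'r set" where
  "lcm_lattice m L = L ` Pow {1..m}"

definition fiber :: "nat \<Rightarrow> (nat set \<Rightarrow> 'r) \<Rightarrow> 'r \<Rightarrow> nat set set" where
  "fiber m L q = {s. s \<subseteq> {1..m} \<and> L s = q}"

definition KQ :: "nat \<Rightarrow> (nat set \<Rightarrow> 'r) \<Rightarrow> 'r \<Rightarrow> nat \<Rightarrow> (nat set \<Rightarrow>\<^sub>0 'k::comm_ring_1) set" where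
  "KQ m L q p = {c \<in> chains m p. Poly_Mapping.keys c \<subseteq> fiber m L q}"

definition projQ ::
  "nat \<Rightarrow> (nat set \<Rightarrow> 'r) \<Rightarrow> 'r \<Rightarrow> (nat set \<Rightarrow>\<^sub>0 'k::comm_ring_1) \<Rightarrow> (nat set \<Rightarrow>\<^sub>0 'k)" where
  "projQ m L q c =
     (\<Sum>s\<in>fiber m L q. Poly_Mapping.single s (Poly_Mapping.lookup c s))"

definition diffQ ::
  "nat \<Rightarrow> (nat set \<Rightarrow> 'r) \<Rightarrow> 'r \<Rightarrow> (nat set \<Rightarrow>\<^sub>0 'k::comm_ring_1) \<Rightarrow> (nat set \<Rightarrow>\<^sub>0 'k)" where
  "diffQ m L q c = projQ m L q (diff c)"

definition cyclesQ ::
  "nat \<Rightarrow> (nat set \<Rightarrow> 'r) \<Rightarrow> 'r \<Rightarrow> nat \<Rightarrow> (nat set \<Rightarrow>\<^sub>0 'k::comm_ring_1) set" where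
  "cyclesQ m L q p = {c \<in> KQ m L q p. diffQ m L q c = 0}"

definition boundariesQ ::
  "nat \<Rightarrow> (nat set \<Rightarrow> 'r) \<Rightarrow> 'r \<Rightarrow> nat \<Rightarrow> (nat set \<Rightarrow>\<^sub>0 'k::comm_ring_1) set" where
  "boundariesQ m L q p = diffQ m L q ` KQ m L q (p + 1)"

text \<open>The type argument fixes the field of coefficients, which the argument \<open>L\<close> does not
  determine.\<close>

definition exact_KQ :: "'k::comm_ring_1 itself \<Rightarrow> nat \<Rightarrow> (nat set \<Rightarrow> 'r) \<Rightarrow> 'r \<Rightarrow> bool" where
  "exact_KQ _ m L q \<longleftrightarrow>
     (\<forall>p. (cyclesQ m L q p :: (nat set \<Rightarrow>\<^sub>0 'k) set) = boundariesQ m L q p)"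

definition direct_sum_of ::
  "('b \<Rightarrow>\<^sub>0 'k::comm_ring_1) set \<Rightarrow> ('b \<Rightarrow>\<^sub>0 'k) set \<Rightarrow> ('b \<Rightarrow>\<^sub>0 'k) set \<Rightarrow> bool" where
  "direct_sum_of V U W \<longleftrightarrow>
     module.subspace smul U \<and> module.subspace smul W \<and>
     V = {u + w | u w. u \<in> U \<and> w \<in> W} \<and> U \<inter> W = {0}"

text \<open>\<open>H q p\<close> is H'(q)_p. \<open>B' q p\<close> is indexed by the degree of the chains it consists of, so it is
  the space B'(q)_{p-1}, contained in K(q)_p.\<close>

definition splitting ::
  "nat \<Rightarrow> (nat set \<Rightarrow> 'r) \<Rightarrow> ('r \<Rightarrow> nat \<Rightarrow> (nat set \<Rightarrow>\<^sub>0 'k::comm_ring_1) set) \<Rightarrow>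
   ('r \<Rightarrow> nat \<Rightarrow> (nat set \<Rightarrow>\<^sub>0 'k) set) \<Rightarrow> bool" where
  "splitting m L H B' \<longleftrightarrow>
     (\<forall>q\<in>lcm_lattice m L. \<forall>p.
        direct_sum_of (cyclesQ m L q p) (boundariesQ m L q p) (H q p) \<and>
        direct_sum_of (KQ m L q p) (cyclesQ m L q p) (B' q p))"


section \<open>The map f, the complex generated by the lifted elements, and the Scarf complex\<close>

text \<open>\<open>f_map m L H B' p\<close> is f on H'_p; the sums of subspaces below are automatically direct, because
  K is the direct sum of all K(q)_p.\<close>

definition f_map ::
  "nat \<Rightarrow> (nat set \<Rightarrow> 'r) \<Rightarrow> ('r \<Rightarrow> nat \<Rightarrow> (nat set \<Rightarrow>\<^sub>0 'k::comm_ring_1) set) \<Rightarrow>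
   ('r \<Rightarrow> nat \<Rightarrow> (nat set \<Rightarrow>\<^sub>0 'k) set) \<Rightarrow> nat \<Rightarrow> (nat set \<Rightarrow>\<^sub>0 'k) \<Rightarrow> (nat set \<Rightarrow>\<^sub>0 'k)" where
  "f_map m L H B' p a =
     (THE b. b \<in> module.span smul (\<Union>q\<in>lcm_lattice m L. B' q p) \<and>
             diff (a + b) \<in> module.span smul (\<Union>q\<in>lcm_lattice m L. \<Union>j. H q j \<union> B' q j))"

definition embed :: "(nat set \<Rightarrow>\<^sub>0 'k::comm_ring_1) \<Rightarrow> (nat set \<Rightarrow>\<^sub>0 ('x, 'k) mpoly)" where
  "embed c = Poly_Mapping.map const_poly c"

definition lift ::
  "nat \<Rightarrow> (nat set \<Rightarrow> ('x, 'k::comm_ring_1) mpoly) \<Rightarrow>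
   (('x, 'k) mpoly \<Rightarrow> nat \<Rightarrow> (nat set \<Rightarrow>\<^sub>0 'k) set) \<Rightarrow>
   (('x, 'k) mpoly \<Rightarrow> nat \<Rightarrow> (nat set \<Rightarrow>\<^sub>0 'k) set) \<Rightarrow>
   ('x, 'k) mpoly \<Rightarrow> nat \<Rightarrow> (nat set \<Rightarrow>\<^sub>0 'k) \<Rightarrow> (nat set \<Rightarrow>\<^sub>0 ('x, 'k) mpoly)" where
  "lift m L H B' q p a =
     embed a + (\<Sum>r\<in>{r \<in> lcm_lattice m L. proper_dvd r q}.
                  smul (quot q r) (embed (projQ m L r (f_map m L H B' p a))))"

text \<open>Lifts of homogeneous a suffice as generators, since a lift is additive in a. The complex carries
  the restriction of the Taylor differential.\<close>

definition M_complex ::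
  "nat \<Rightarrow> (nat set \<Rightarrow> ('x, 'k::comm_ring_1) mpoly) \<Rightarrow>
   (('x, 'k) mpoly \<Rightarrow> nat \<Rightarrow> (nat set \<Rightarrow>\<^sub>0 'k) set) \<Rightarrow>
   (('x, 'k) mpoly \<Rightarrow> nat \<Rightarrow> (nat set \<Rightarrow>\<^sub>0 'k) set) \<Rightarrow> (nat set \<Rightarrow>\<^sub>0 ('x, 'k) mpoly) set" where
  "M_complex m L H B' =
     module.span smul {lift m L H B' q p a | q p a. q \<in> lcm_lattice m L \<and> a \<in> H q p}"

definition scarf_complex ::
  "nat \<Rightarrow> (nat set \<Rightarrow> 'r) \<Rightarrow> (nat set \<Rightarrow>\<^sub>0 'r::comm_ring_1) set" where
  "scarf_complex m L =
     module.span smul {Poly_Mapping.single s 1 | s. s \<subseteq> {1..m} \<and> card (fiber m L (L s)) = 1}"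

end

theory Submission
  imports Defs "HOL-Computational_Algebra.Polynomial"
begin

text \<open>If \<open>a \<noteq> 0\<close> lies in \<open>H' q\<close>, the corrections in its lift live in strictly smaller degrees of the lcm
  lattice, so the lift has the coefficients of \<open>a\<close> on the fiber of \<open>q\<close>; if the lift lies in the Scarf complex,
  this fiber is therefore a singleton. Hence, if the two complexes coincide, \<open>H' q = 0\<close>, i.e. \<open>K q\<close> is exact,
  for every other \<open>q\<close>. Conversely, the Scarf faces are closed under subsets, so the boundary of a Scarf face lies
  in \<open>H'\<close>; then the map \<open>f\<close> vanishes on \<open>H'\<close> and the lifts are the Scarf faces themselves.

  For acyclicity, a Scarf cycle is a boundary \<open>d e\<close> in the Taylor complex. A component of \<open>e\<close> in a maximal
  degree \<open>q\<close> outside the Scarf complex is a cycle of the exact complex \<open>K q \<otimes> S\<close>, so subtracting a Taylor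
  boundary removes it and only affects degrees dividing \<open>q\<close>.

  The labels are compared up to equality and not merely up to units, which requires products of the chosen
  irreducible factors to be unique. So one needs that the polynomial ring is factorial.\<close>

section \<open>Polynomials over a factorial subring\<close>

text \<open>The value of \<open>f\<close> is given by a definite description, and it is met in two
  situations. A lift is compared with \<open>a\<close> on the fiber of \<open>q\<close>, where no
  correction term is present. And when \<open>diff a\<close> already lies in \<open>H' + B'\<close>,
  the zero chain satisfies the description, so uniqueness alone yields \<open>f(a) = 0\<close>. In
  the ring part, irreducibility always refers to the full polynomial ring, while primality is tested
  against polynomials in a subset of the variables, which grows along the induction. Gauss's lemma
  is organized without fractions and contents: if a constant multiple of \<open>p\<close> factors,
  the prime factors of the constant are cancelled one at a time against the two factors.\<close>

text \<open>Factoriality of \<open>k[x\<^sub>1,\<dots>,x\<^sub>n]\<close> is proved by induction on the set of variables, and the number of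
  variables is a type. So the coefficient rings of the induction are subrings of one fixed domain; closure
  under factors makes divisibility in the subring agree with divisibility in that domain.\<close>

locale factor_closed_subring =
  fixes D :: "'a::idom set"
  assumes zero: "0 \<in> D" and one: "1 \<in> D"
    and add: "a \<in> D \<Longrightarrow> b \<in> D \<Longrightarrow> a + b \<in> D"
    and neg: "a \<in> D \<Longrightarrow> - a \<in> D"
    and mult: "a \<in> D \<Longrightarrow> b \<in> D \<Longrightarrow> a * b \<in> D"
    and factor: "a * b \<in> D \<Longrightarrow> a * b \<noteq> 0 \<Longrightarrow> a \<in> D"
begin

lemma sub: "a \<in> D \<Longrightarrow> b \<in> D \<Longrightarrow> a - b \<in> D"
  using add[of a "- b"] neg[of b] by simp

lemma sum: "(\<And>i. i \<in> J \<Longrightarrow> g i \<in> D) \<Longrightarrow> sum g J \<in> D"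
  by (induction J rule: infinite_finite_induct) (auto intro: zero add)

lemma factor': "a \<in> D \<Longrightarrow> a * b \<in> D \<Longrightarrow> a \<noteq> 0 \<Longrightarrow> b \<in> D"
  using factor[of b a] zero by (cases "b = 0") (simp_all add: mult.commute)

section \<open>Polynomials with coefficients in the subring\<close>

definition polys :: "'a poly set" where
  "polys = {f. \<forall>i. coeff f i \<in> D}"

lemma polys_const: "[:c:] \<in> polys \<longleftrightarrow> c \<in> D"
  by (auto simp: polys_def coeff_pCons zero split: nat.splits dest: spec[of _ 0])

lemma polys_monom: "c \<in> D \<Longrightarrow> monom c n \<in> polys"
  by (auto simp: polys_def zero)

lemma polys_zero: "0 \<in> polys" and polys_one: "1 \<in> polys"
  using polys_const[of 0] polys_const[of 1] zero one by (auto simp: one_pCons)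

lemma polys_add: "f \<in> polys \<Longrightarrow> g \<in> polys \<Longrightarrow> f + g \<in> polys"
  by (simp add: polys_def add)

lemma polys_diff: "f \<in> polys \<Longrightarrow> g \<in> polys \<Longrightarrow> f - g \<in> polys"
  by (simp add: polys_def sub)

lemma polys_mult: "f \<in> polys \<Longrightarrow> g \<in> polys \<Longrightarrow> f * g \<in> polys"
  by (auto simp: polys_def coeff_mult intro!: sum mult)

lemma polys_smult: "c \<in> D \<Longrightarrow> f \<in> polys \<Longrightarrow> smult c f \<in> polys"
  by (simp add: polys_def mult)

lemma polys_lead: "f \<in> polys \<Longrightarrow> lead_coeff f \<in> D"
  by (simp add: polys_def)

lemma polys_smultD:
  assumes "c \<in> D" "c \<noteq> 0" "smult c f \<in> polys"
  shows "f \<in> polys"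
  using factor'[OF assms(1) _ assms(2)] assms(3) by (simp add: polys_def)

text \<open>The leading coefficient of \<open>h\<close> is a factor of an element of
  \<open>D\<close>, hence in \<open>D\<close>, and subtracting the leading term lowers the degree.
  So a quotient formed in the ambient polynomial ring stays over \<open>D\<close>.\<close>

lemma polys_quotient:
  assumes "p \<in> polys" "p \<noteq> 0" "p * h \<in> polys"
  shows "h \<in> polys"
  using assms(3)
proof (induction "degree h" arbitrary: h rule: less_induct)
  case less
  show ?case
  proof (cases "h = 0")
    case False
    have "lead_coeff p * lead_coeff h \<in> D"
      using polys_lead[OF less.prems] by (simp add: lead_coeff_mult)
    hence lh: "lead_coeff h \<in> D"
      using factor'[OF polys_lead[OF assms(1)]] assms(2) by simp
    define h' where "h' = h - monom (lead_coeff h) (degree h)"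
    have "p * h' \<in> polys"
      using less.prems assms(1) lh
      by (auto simp: h'_def right_diff_distrib intro!: polys_diff polys_mult polys_monom)
    moreover have "h' = 0 \<or> degree h' < degree h"
      using degree_diff_le[of h "degree h" "monom (lead_coeff h) (degree h)"]
        eq_zero_or_degree_less[of h' "degree h"]
      by (simp add: h'_def degree_monom_le)
    ultimately have "h' \<in> polys"
      using less.hyps polys_zero by blast
    thus ?thesis
      using polys_add[OF _ polys_monom[OF lh, of "degree h"], of h'] by (simp add: h'_def)
  qed (simp add: polys_zero)
qed

text \<open>Leading coefficients need not be invertible in \<open>D\<close>, so \<open>f\<close> is
  multiplied by that of \<open>g\<close> at each reduction; these factors accumulate in
  \<open>c\<close>.\<close>

lemma pseudo_division:
  assumes "g \<in> polys" "g \<noteq> 0" "f \<in> polys"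
  shows "\<exists>c q r. c \<in> D \<and> c \<noteq> 0 \<and> q \<in> polys \<and> r \<in> polys \<and> smult c f = g * q + r \<and>
           (r = 0 \<or> degree r < degree g)"
  using assms(3)
proof (induction "degree f" arbitrary: f rule: less_induct)
  case less
  show ?case
  proof (cases "f = 0 \<or> degree f < degree g")
    case True
    thus ?thesis
      using less.prems one polys_zero by (intro exI[of _ 1] exI[of _ 0] exI[of _ f]) auto
  next
    case False
    define k where "k = degree f - degree g"
    define b where "b = lead_coeff g"
    define t where "t = monom (lead_coeff f) k"
    have b: "b \<in> D" "b \<noteq> 0" and t: "t \<in> polys"
      using assms polys_lead less.prems by (auto simp: b_def t_def intro: polys_monom)
    define f' where "f' = smult b f - g * t"
    have f': "f' \<in> polys"
      using b t assms(1) less.prems by (auto simp: f'_def intro!: polys_diff polys_smult polys_mult)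
    have deg: "degree (smult b f) = degree f" "degree (g * t) = degree f"
      using False b assms(2) by (auto simp: t_def k_def degree_mult_eq degree_monom_eq)
    have "lead_coeff (g * t) = b * lead_coeff f"
      by (simp only: lead_coeff_mult b_def t_def lead_coeff_monom)
    hence "coeff (g * t) (degree f) = b * lead_coeff f"
      unfolding deg(2) .
    hence "coeff f' (degree f) = 0"
      by (simp add: f'_def)
    hence "f' = 0 \<or> degree f' < degree f"
      using degree_diff_le[of "smult b f" "degree f" "g * t"] deg eq_zero_or_degree_less[of f' "degree f"]
      by (auto simp: f'_def)
    then obtain c q r where c: "c \<in> D" "c \<noteq> 0" "q \<in> polys" "r \<in> polys"
      "smult c f' = g * q + r" "r = 0 \<or> degree r < degree g"
    proof
      assume "f' = 0"
      thus ?thesis using that[of 1 0 0] one polys_zero by simp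
    next
      assume "degree f' < degree f"
      thus ?thesis using that less.hyps[OF _ f'] by blast
    qed
    have "smult (c * b) f = g * (q + smult c t) + r"
      using c(5) by (simp add: f'_def algebra_simps smult_diff_right)
    thus ?thesis
      using c b t by (intro exI[of _ "c * b"] exI[of _ "q + smult c t"] exI[of _ r])
        (auto intro!: mult polys_add polys_smult)
  qed
qed

text \<open>Primality is tested only against elements of \<open>D\<close>, which is what the
  induction on the variables provides. Divisibility is that of the ambient domain; between elements
  of \<open>D\<close> the cofactor of a nonzero divisor lies in \<open>D\<close> by
  \<open>factor'\<close>.\<close>

definition relprime :: "'a \<Rightarrow> bool" where
  "relprime p \<longleftrightarrow> p \<in> D \<and> p \<noteq> 0 \<and> \<not> p dvd 1 \<and>
     (\<forall>a\<in>D. \<forall>b\<in>D. p dvd a * b \<longrightarrow> p dvd a \<or> p dvd b)"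

text \<open>Gauss's argument: if \<open>i\<close> and \<open>j\<close> are the first positions where
  \<open>d\<close> fails to divide, then all terms but one of the coefficient of
  \<open>g * h\<close> at \<open>i + j\<close> are divisible by \<open>d\<close>, and the remaining
  one is a product of two elements of \<open>D\<close> that are not.\<close>

lemma gauss_const:
  assumes d: "relprime d" and "g \<in> polys" "h \<in> polys" and dvd: "[:d:] dvd g * h"
  shows "[:d:] dvd g \<or> [:d:] dvd h"
proof (rule ccontr)
  assume "\<not> ?thesis"
  hence ex: "\<exists>i. \<not> d dvd coeff g i" "\<exists>i. \<not> d dvd coeff h i"
    by (auto simp: const_poly_dvd_iff)
  define i where "i = (LEAST i. \<not> d dvd coeff g i)"
  define j where "j = (LEAST j. \<not> d dvd coeff h j)"
  have i: "\<not> d dvd coeff g i" "\<And>k. k < i \<Longrightarrow> d dvd coeff g k"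
    using LeastI_ex[OF ex(1)] not_less_Least[of _ "\<lambda>i. \<not> d dvd coeff g i"]
    unfolding i_def by blast+
  have j: "\<not> d dvd coeff h j" "\<And>k. k < j \<Longrightarrow> d dvd coeff h k"
    using LeastI_ex[OF ex(2)] not_less_Least[of _ "\<lambda>j. \<not> d dvd coeff h j"]
    unfolding j_def by blast+
  have "coeff (g * h) (i + j) = (\<Sum>k\<in>{..i+j} - {i}. coeff g k * coeff h (i + j - k)) + coeff g i * coeff h j"
    by (simp add: coeff_mult sum.remove[of _ i])
  moreover have "d dvd (\<Sum>k\<in>{..i+j} - {i}. coeff g k * coeff h (i + j - k))"
  proof (rule dvd_sum)
    fix k assume "k \<in> {..i+j} - {i}"
    hence "k < i \<or> i + j - k < j" by auto
    thus "d dvd coeff g k * coeff h (i + j - k)"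
      using i j by auto
  qed
  moreover have "d dvd coeff (g * h) (i + j)"
    using dvd by (auto simp: const_poly_dvd_iff)
  ultimately have "d dvd coeff g i * coeff h j"
    by (simp add: dvd_add_right_iff)
  thus False
    using d i(1) j(1) assms(2,3) by (auto simp: relprime_def polys_def)
qed

end

text \<open>Only existence of factorizations is stated; as the factors are prime relative to
  \<open>D\<close>, uniqueness is built in.\<close>

locale relative_ufd = factor_closed_subring +
  assumes factorization:
    "c \<in> D \<Longrightarrow> c \<noteq> 0 \<Longrightarrow> \<exists>u F. u \<in> D \<and> u dvd 1 \<and> (\<forall>r\<in>#F. relprime r) \<and> c = u * prod_mset F"
begin

text \<open>This takes the place of contents and the fraction field: each prime constant on the left
  divides \<open>g\<close> or \<open>q\<close> by \<open>gauss_const\<close> and is cancelled there,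
  until \<open>p\<close> itself factors.\<close>

lemma distribute_primes:
  assumes "\<forall>r\<in>#F. relprime r" "p \<in> polys" "g \<in> polys" "q \<in> polys" "smult (prod_mset F) p = g * q"
  shows "\<exists>c1 c2 g1 q1. c1 \<in> D \<and> c2 \<in> D \<and> c1 \<noteq> 0 \<and> c2 \<noteq> 0 \<and> g1 \<in> polys \<and> q1 \<in> polys \<and>
    g = smult c1 g1 \<and> q = smult c2 q1 \<and> p = g1 * q1"
  using assms
proof (induction F arbitrary: g q)
  case empty
  thus ?case using one by (intro exI[of _ 1] exI[of _ g] exI[of _ q]) auto
next
  case (add r F)
  have r: "relprime r" "r \<in> D" "r \<noteq> 0" using add.prems by (auto simp: relprime_def)
  have eq: "smult r (smult (prod_mset F) p) = g * q" using add.prems by simp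
  hence "[:r:] dvd g * q" using dvd_triv_left[of "[:r:]" "smult (prod_mset F) p"] by (simp add: mult.commute)
  from gauss_const[OF r(1) add.prems(3,4) this] show ?case
  proof
    assume "[:r:] dvd g"
    then obtain g' where g': "g = smult r g'" by (auto elim!: dvdE)
    have "g' \<in> polys" using polys_smultD[OF r(2,3)] add.prems g' by simp
    moreover have "smult (prod_mset F) p = g' * q"
      by (rule smult_cancel[OF r(3)]) (use eq in \<open>simp add: g' mult.commute\<close>)
    ultimately obtain c1 c2 g1 q1 where
      "c1 \<in> D" "c2 \<in> D" "c1 \<noteq> 0" "c2 \<noteq> 0" "g1 \<in> polys" "q1 \<in> polys"
      "g' = smult c1 g1" "q = smult c2 q1" "p = g1 * q1"
      using add.IH[of g' q] add.prems by auto
    thus ?thesis using r g'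
      by (intro exI[of _ "r * c1"] exI[of _ c2] exI[of _ g1] exI[of _ q1]) (auto intro: mult)
  next
    assume "[:r:] dvd q"
    then obtain q' where q': "q = smult r q'" by (auto elim!: dvdE)
    have "q' \<in> polys" using polys_smultD[OF r(2,3)] add.prems q' by simp
    moreover have "smult (prod_mset F) p = g * q'"
      by (rule smult_cancel[OF r(3)]) (use eq in \<open>simp add: q' mult.commute\<close>)
    ultimately obtain c1 c2 g1 q1 where
      "c1 \<in> D" "c2 \<in> D" "c1 \<noteq> 0" "c2 \<noteq> 0" "g1 \<in> polys" "q1 \<in> polys"
      "g = smult c1 g1" "q' = smult c2 q1" "p = g1 * q1"
      using add.IH[of g q'] add.prems by auto
    thus ?thesis using r q'
      by (intro exI[of _ c1] exI[of _ "r * c2"] exI[of _ g1] exI[of _ q1]) (auto intro: mult)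
  qed
qed

text \<open>The unit of the factorization is first moved over to \<open>g\<close> through its
  inverse, and returned to the constant \<open>c1\<close> at the end.\<close>

lemma distribute_const:
  assumes "c \<in> D" "c \<noteq> 0" "p \<in> polys" "g \<in> polys" "q \<in> polys" "smult c p = g * q"
  shows "\<exists>c1 c2 g1 q1. c1 \<in> D \<and> c2 \<in> D \<and> c1 \<noteq> 0 \<and> c2 \<noteq> 0 \<and> g1 \<in> polys \<and> q1 \<in> polys \<and>
    g = smult c1 g1 \<and> q = smult c2 q1 \<and> p = g1 * q1"
proof -
  obtain u F where u: "u \<in> D" "u dvd 1" "\<forall>r\<in>#F. relprime r" "c = u * prod_mset F"
    using factorization assms by blast
  then obtain v where v: "u * v = 1" by (auto elim!: dvdE)
  hence "u \<noteq> 0" "v \<noteq> 0" by auto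
  have "v \<in> D" using factor'[OF u(1) _ \<open>u \<noteq> 0\<close>, of v] v one by simp
  have "smult (prod_mset F) p = smult v g * q"
    using arg_cong[OF assms(6), of "smult v"] v by (simp add: u(4) mult.assoc[symmetric] mult.commute[of v])
  then obtain c1 c2 g1 q1 where
      *: "c1 \<in> D" "c2 \<in> D" "c1 \<noteq> 0" "c2 \<noteq> 0" "g1 \<in> polys" "q1 \<in> polys"
      "smult v g = smult c1 g1" "q = smult c2 q1" "p = g1 * q1"
    using distribute_primes[OF u(3) assms(3) _ assms(5), of "smult v g"] polys_smult \<open>v \<in> D\<close> assms by blast
  have "g = smult (u * c1) g1"
    using arg_cong[OF *(7), of "smult u"] v by simp
  thus ?thesis using * u \<open>u \<noteq> 0\<close>
    by (intro exI[of _ "u * c1"] exI[of _ c2] exI[of _ g1] exI[of _ q1]) (auto intro: mult)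
qed

definition irred :: "'a poly \<Rightarrow> bool" where
  "irred p \<longleftrightarrow> p \<in> polys \<and> p \<noteq> 0 \<and> \<not> p dvd 1 \<and>
     (\<forall>g\<in>polys. \<forall>h\<in>polys. p = g * h \<longrightarrow> g dvd 1 \<or> h dvd 1)"

lemma irred_dvd_smult:
  assumes p: "irred p" "degree p > 0" and a: "a \<in> polys" and c: "c \<in> D" "c \<noteq> 0"
    and dvd: "p dvd smult c a"
  shows "p dvd a"
proof -
  from dvd obtain h where h: "smult c a = p * h" by (auto elim!: dvdE)
  have pp: "p \<in> polys" "p \<noteq> 0" using p by (auto simp: irred_def)
  have "h \<in> polys" using polys_quotient[OF pp] h polys_smult[OF c(1) a] by simp
  then obtain c1 c2 g1 q1 where *: "c1 \<in> D" "c2 \<in> D" "c1 \<noteq> 0" "c2 \<noteq> 0" "g1 \<in> polys" "q1 \<in> polys"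
      "p = smult c1 g1" "h = smult c2 q1" "a = g1 * q1"
    using distribute_const[OF c a pp(1) _ h] by blast
  have "p = [:c1:] * g1" using * by simp
  hence "[:c1:] dvd 1 \<or> g1 dvd 1" using p * by (auto simp: irred_def polys_const)
  moreover have "\<not> g1 dvd 1"
  proof
    assume "g1 dvd 1"
    hence "degree g1 = 0" using dvd_imp_degree_le[of g1 1] by simp
    thus False using p * by simp
  qed
  ultimately have "c1 dvd 1" using const_poly_dvd_const_poly_iff[of c1 1] by (simp add: one_pCons)
  then obtain v where "c1 * v = 1" by (auto elim!: dvdE)
  hence "g1 = smult v p" using * by (simp add: mult.commute)
  hence "p dvd g1" by (metis dvd_refl dvd_smult)
  thus ?thesis using * by simp
qed

text \<open>In positive degree, a nonzero element \<open>g\<close> of least degree of the ideal \<open>(p, a)\<close> divides \<open>p\<close> and \<open>a\<close> up to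
  nonzero constants, by pseudo-division. Removing the constants from \<open>c p = g q\<close> shows that \<open>g\<close> is, up to a
  constant and a unit, either \<open>p\<close>, which then divides \<open>a\<close>, or 1; then \<open>p\<close> divides \<open>g b\<close> and hence \<open>b\<close>.\<close>

lemma irred_imp_prime:
  assumes p: "irred p" and ab: "a \<in> polys" "b \<in> polys" and dvd: "p dvd a * b"
  shows "p dvd a \<or> p dvd b"
proof (cases "degree p = 0")
  case True
  then obtain d where d: "p = [:d:]" by (auto elim: degree_eq_zeroE)
  have dD: "d \<in> D" "d \<noteq> 0" using p d by (auto simp: irred_def polys_const)
  obtain u F where u: "u \<in> D" "u dvd 1" "\<forall>r\<in>#F. relprime r" "d = u * prod_mset F"
    using factorization[OF dD] by blast
  have "F \<noteq> {#}"
  proof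
    assume "F = {#}"
    hence "[:d:] dvd [:1:]" using u by simp
    thus False using p d by (simp add: irred_def one_pCons)
  qed
  then obtain r F' where F: "F = add_mset r F'" by (meson multiset_cases)
  define e where "e = u * prod_mset F'"
  have de: "d = r * e" using u F by (simp add: e_def mult_ac)
  have r: "relprime r" "r \<in> D" "r \<noteq> 0" using u F by (auto simp: relprime_def)
  have "e \<in> D" using factor'[of r e] de dD r by simp
  have "p = [:r:] * [:e:]" using d de by simp
  hence "[:r:] dvd 1 \<or> [:e:] dvd 1"
    using p r(2) \<open>e \<in> D\<close> by (auto simp: irred_def polys_const)
  hence "r dvd 1 \<or> e dvd 1"
    using const_poly_dvd_const_poly_iff[of r 1] const_poly_dvd_const_poly_iff[of e 1] by (simp add: one_pCons)
  hence "e dvd 1" using r by (auto simp: relprime_def)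
  then obtain v where v: "e * v = 1" by (auto elim!: dvdE)
  have "[:r:] dvd a * b" using dvd \<open>p = [:r:] * [:e:]\<close> dvd_mult_left by blast
  hence "[:r:] dvd a \<or> [:r:] dvd b" using gauss_const r ab by blast
  moreover have "p dvd [:r:]"
  proof -
    have "r = d * v" using v by (simp add: de mult.assoc)
    thus ?thesis by (simp add: d)
  qed
  ultimately show ?thesis using dvd_trans by blast
next
  case False
  have pp: "p \<in> polys" "p \<noteq> 0" using p by (auto simp: irred_def)
  define J where "J = {x * p + y * a | x y. x \<in> polys \<and> y \<in> polys}"
  have pJ: "p \<in> J" using polys_one polys_zero unfolding J_def by force
  have aJ: "a \<in> J" using polys_one polys_zero unfolding J_def by force
  have JD: "J \<subseteq> polys" using pp ab by (auto simp: J_def intro!: polys_add polys_mult)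
  have Jsub: "smult c f - g * q \<in> J" if "f \<in> J" "g \<in> J" "q \<in> polys" "c \<in> D" for c f g q
  proof -
    obtain x y x' y' where *: "f = x * p + y * a" "g = x' * p + y' * a"
      "x \<in> polys" "y \<in> polys" "x' \<in> polys" "y' \<in> polys"
      using \<open>f \<in> J\<close> \<open>g \<in> J\<close> unfolding J_def by blast
    have "smult c f - g * q = (smult c x - x' * q) * p + (smult c y - y' * q) * a"
      using * by (simp add: algebra_simps smult_add_right)
    moreover have "smult c x - x' * q \<in> polys" "smult c y - y' * q \<in> polys"
      using * that by (auto intro!: polys_diff polys_smult polys_mult)
    ultimately show ?thesis unfolding J_def by blast
  qed
  obtain g where g: "g \<in> J" "g \<noteq> 0" "\<And>h. h \<in> J \<Longrightarrow> h \<noteq> 0 \<Longrightarrow> degree g \<le> degree h"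
    using ex_has_least_nat[of "\<lambda>g. g \<in> J \<and> g \<noteq> 0" p degree] pJ pp by blast
  have gp: "g \<in> polys" using g JD by auto
  have mult_of_g: "\<exists>c q. c \<in> D \<and> c \<noteq> 0 \<and> q \<in> polys \<and> smult c f = g * q" if f: "f \<in> J" for f
  proof -
    obtain c q r where *: "c \<in> D" "c \<noteq> 0" "q \<in> polys" "r \<in> polys" "smult c f = g * q + r"
      "r = 0 \<or> degree r < degree g"
      using pseudo_division[OF gp g(2), of f] f JD by blast
    have "r = smult c f - g * q" using * by simp
    hence "r \<in> J" using Jsub[OF f g(1) *(3,1)] by simp
    hence "r = 0" using g(3) *(6) by force
    thus ?thesis using * by auto
  qed
  obtain c q where c: "c \<in> D" "c \<noteq> 0" "q \<in> polys" "smult c p = g * q"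
    using mult_of_g[OF pJ] by blast
  obtain c' q' where c': "c' \<in> D" "c' \<noteq> 0" "q' \<in> polys" "smult c' a = g * q'"
    using mult_of_g[OF aJ] by blast
  obtain c1 c2 g1 q1 where *: "c1 \<in> D" "c2 \<in> D" "c1 \<noteq> 0" "c2 \<noteq> 0" "g1 \<in> polys" "q1 \<in> polys"
      "g = smult c1 g1" "q = smult c2 q1" "p = g1 * q1"
    using distribute_const[OF c(1,2) pp(1) gp c(3,4)] by blast
  have "g1 dvd 1 \<or> q1 dvd 1" using p * by (auto simp: irred_def)
  thus ?thesis
  proof
    assume "q1 dvd 1"
    then obtain w where w: "q1 * w = 1" by (auto elim!: dvdE)
    have "g1 = p * w" using w by (simp add: *(9) mult.assoc)
    hence "p dvd g1" by simp
    hence "p dvd smult c' a" using c'(4) *(7) by (simp add: dvd_smult)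
    thus ?thesis using irred_dvd_smult[OF p _ ab(1) c'(1,2)] False by simp
  next
    assume "g1 dvd 1"
    then obtain w where w: "g1 * w = 1" by (auto elim!: dvdE)
    obtain x y where xy: "g = x * p + y * a" using g(1) unfolding J_def by blast
    have "g * b = x * b * p + y * (a * b)" using xy by (simp add: algebra_simps)
    hence "p dvd g * b" using dvd by simp
    hence "p dvd smult c1 (g1 * b)" using *(7) by simp
    hence "p dvd smult c1 (g1 * b) * w" by (rule dvd_mult2)
    moreover have "smult c1 (g1 * b) * w = smult c1 b"
      using w by (simp add: mult_ac)
    ultimately show ?thesis using irred_dvd_smult[OF p _ ab(2) *(1,3)] False by simp
  qed
qed

end

section \<open>Polynomial rings over a field are factorial\<close>

definition polys_in :: "'x set \<Rightarrow> ('x, 'k::zero) mpoly set" where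
  "polys_in X = {p. \<forall>u\<in>Poly_Mapping.keys p. Poly_Mapping.keys u \<subseteq> X}"

definition var :: "'x \<Rightarrow> ('x, 'k::zero_neq_one) mpoly" where
  "var y = Poly_Mapping.single (Poly_Mapping.single y 1) 1"

lemma poly_mapping_sum_single:
  "p = (\<Sum>u\<in>Poly_Mapping.keys p. Poly_Mapping.single u (Poly_Mapping.lookup p u))"
  by (rule poly_mapping_eqI)
    (simp add: lookup_sum lookup_single when_def sum.delta in_keys_iff)

lemma polys_in_mono: "X \<subseteq> Y \<Longrightarrow> polys_in X \<subseteq> polys_in Y"
  by (auto simp: polys_in_def)

lemma polys_in_UNIV [simp]: "polys_in UNIV = UNIV"
  by (simp add: polys_in_def)

lemma polys_in_zero: "0 \<in> polys_in X"
  and polys_in_one: "(1::('x, 'k::zero_neq_one) mpoly) \<in> polys_in X"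
  by (auto simp: polys_in_def simp flip: single_one)

lemma polys_in_add:
  fixes p q :: "('x, 'k::comm_ring_1) mpoly"
  shows "p \<in> polys_in X \<Longrightarrow> q \<in> polys_in X \<Longrightarrow> p + q \<in> polys_in X"
  using keys_add[of p q] by (auto simp: polys_in_def)

lemma polys_in_uminus:
  fixes p :: "('x, 'k::comm_ring_1) mpoly"
  shows "p \<in> polys_in X \<Longrightarrow> - p \<in> polys_in X"
  by (auto simp: polys_in_def)

lemma polys_in_mult:
  fixes p q :: "('x, 'k::comm_ring_1) mpoly"
  assumes "p \<in> polys_in X" "q \<in> polys_in X"
  shows "p * q \<in> polys_in X"
  unfolding polys_in_def
proof safe
  fix u x assume "u \<in> Poly_Mapping.keys (p * q)" "x \<in> Poly_Mapping.keys u"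
  moreover from this obtain a b where "u = a + b" "a \<in> Poly_Mapping.keys p" "b \<in> Poly_Mapping.keys q"
    using keys_mult[of p q] by blast
  ultimately show "x \<in> X"
    using assms keys_add[of a b] unfolding polys_in_def by blast
qed

lemma polys_in_sum:
  fixes g :: "'i \<Rightarrow> ('x, 'k::comm_ring_1) mpoly"
  shows "(\<And>i. i \<in> J \<Longrightarrow> g i \<in> polys_in X) \<Longrightarrow> sum g J \<in> polys_in X"
  by (induction J rule: infinite_finite_induct) (auto intro: polys_in_zero polys_in_add)

lemma var_power: "(var y :: ('x, 'k::comm_ring_1) mpoly) ^ i = Poly_Mapping.single (Poly_Mapping.single y i) 1"
  by (induction i) (simp_all add: var_def mult_single flip: single_add)

lemma lookup_single_times:
  fixes f :: "'a::cancel_comm_monoid_add \<Rightarrow>\<^sub>0 'k::comm_ring_1"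
  shows "Poly_Mapping.lookup (Poly_Mapping.single t c * f) (t + v) = c * Poly_Mapping.lookup f v"
  by (simp add: lookup_mult lookup_single when_mult)

text \<open>No coefficient involves \<open>y\<close>, so all monomials of the \<open>i\<close>-th
  term have exponent exactly \<open>i\<close> in \<open>y\<close>, and different terms cannot
  cancel. Together with \<open>poly_var_surj\<close>, evaluation at \<open>y\<close> identifies
  univariate polynomials over a ring without \<open>y\<close> with polynomials involving
  \<open>y\<close>.\<close>

lemma poly_var_inj0:
  fixes f :: "('x, 'k::comm_ring_1) mpoly poly"
  assumes "\<And>i. coeff f i \<in> polys_in (UNIV - {y})" and "poly f (var y) = 0"
  shows "f = 0"
proof (rule poly_eqI, rule poly_mapping_eqI)
  fix j v
  let ?e = "\<lambda>i. Poly_Mapping.single y i :: 'x \<Rightarrow>\<^sub>0 nat"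
  show "Poly_Mapping.lookup (coeff f j) v = Poly_Mapping.lookup (coeff 0 j) v"
  proof (rule ccontr)
    assume nz: "\<not> ?thesis"
    hence v: "v \<in> Poly_Mapping.keys (coeff f j)" by (simp add: in_keys_iff)
    hence yv: "Poly_Mapping.lookup v y = 0"
      using assms(1)[of j] by (auto simp: polys_in_def in_keys_iff subset_iff)
    have j: "j \<le> degree f" using nz by (intro le_degree) auto
    have other: "Poly_Mapping.lookup (coeff f i * var y ^ i) (?e j + v) = 0" if "i \<noteq> j" for i
    proof (rule ccontr)
      assume "\<not> ?thesis"
      hence "?e j + v \<in> Poly_Mapping.keys (coeff f i * var y ^ i)" by (simp add: in_keys_iff)
      then obtain a where a: "?e j + v = a + ?e i" "a \<in> Poly_Mapping.keys (coeff f i)"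
        using keys_mult[of "coeff f i" "var y ^ i"] by (auto simp: var_power)
      hence "Poly_Mapping.lookup a y = 0"
        using assms(1)[of i] by (auto simp: polys_in_def in_keys_iff subset_iff)
      thus False
        using arg_cong[OF a(1), of "\<lambda>u. Poly_Mapping.lookup u y"] yv that
        by (simp add: lookup_add)
    qed
    have "0 = Poly_Mapping.lookup (poly f (var y)) (?e j + v)" by (simp add: assms)
    also have "\<dots> = (\<Sum>i\<le>degree f. Poly_Mapping.lookup (coeff f i * var y ^ i) (?e j + v))"
      by (simp add: poly_altdef lookup_sum)
    also have "\<dots> = Poly_Mapping.lookup (coeff f j * var y ^ j) (?e j + v)"
      using other j by (subst sum.remove[of _ j]) auto
    also have "\<dots> = Poly_Mapping.lookup (coeff f j) v"
      using lookup_single_times[of "?e j" 1 "coeff f j" v] by (simp add: var_power mult.commute)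
    finally show False using nz by simp
  qed
qed

lemma poly_var_inj:
  fixes f g :: "('x, 'k::comm_ring_1) mpoly poly"
  assumes "\<And>i. coeff f i \<in> polys_in (UNIV - {y})" "\<And>i. coeff g i \<in> polys_in (UNIV - {y})"
    and "poly f (var y) = poly g (var y)"
  shows "f = g"
proof -
  have "f - g = 0"
  proof (rule poly_var_inj0)
    show "coeff (f - g) i \<in> polys_in (UNIV - {y})" for i
      using polys_in_add[OF assms(1)[of i] polys_in_uminus[OF assms(2)[of i]]] by simp
    show "poly (f - g) (var y) = 0" by (simp add: assms(3))
  qed
  thus ?thesis by simp
qed

lemma poly_var_surj:
  fixes p :: "('x, 'k::comm_ring_1) mpoly"
  assumes "p \<in> polys_in (insert y X)"
  obtains f where "\<And>i. coeff f i \<in> polys_in (X - {y})" "p = poly f (var y)"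
proof
  let ?m = "\<lambda>u. u - Poly_Mapping.single y (Poly_Mapping.lookup u y)"
  define f where "f = (\<Sum>u\<in>Poly_Mapping.keys p.
    monom (Poly_Mapping.single (?m u) (Poly_Mapping.lookup p u)) (Poly_Mapping.lookup u y))"
  show "coeff f i \<in> polys_in (X - {y})" for i
    unfolding f_def coeff_sum
  proof (rule polys_in_sum)
    fix u assume u: "u \<in> Poly_Mapping.keys p"
    have "Poly_Mapping.keys (?m u) \<subseteq> X - {y}"
    proof
      fix x assume "x \<in> Poly_Mapping.keys (?m u)"
      hence "x \<noteq> y \<and> x \<in> Poly_Mapping.keys u"
        by (auto simp: in_keys_iff lookup_minus lookup_single when_def split: if_splits)
      thus "x \<in> X - {y}" using assms u unfolding polys_in_def by blast
    qed
    thus "coeff (monom (Poly_Mapping.single (?m u) (Poly_Mapping.lookup p u)) (Poly_Mapping.lookup u y)) i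
        \<in> polys_in (X - {y})"
      by (cases "Poly_Mapping.lookup u y = i") (simp_all add: polys_in_def)
  qed
  have "?m u + Poly_Mapping.single y (Poly_Mapping.lookup u y) = u" for u :: "'x \<Rightarrow>\<^sub>0 nat"
    by (rule poly_mapping_eqI) (auto simp: lookup_add lookup_minus lookup_single when_def)
  hence "poly f (var y) = (\<Sum>u\<in>Poly_Mapping.keys p. Poly_Mapping.single u (Poly_Mapping.lookup p u))"
    by (simp add: f_def poly_sum poly_monom var_power mult_single)
  also have "\<dots> = p" by (rule poly_mapping_sum_single[symmetric])
  finally show "p = poly f (var y)" by (rule sym)
qed

definition as_poly :: "'x \<Rightarrow> ('x, 'k::comm_ring_1) mpoly \<Rightarrow> ('x, 'k) mpoly poly" where
  "as_poly y p = (SOME f. (\<forall>i. coeff f i \<in> polys_in (UNIV - {y})) \<and> p = poly f (var y))"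

lemma as_poly:
  fixes p :: "('x, 'k::comm_ring_1) mpoly"
  shows "coeff (as_poly y p) i \<in> polys_in (UNIV - {y})" "poly (as_poly y p) (var y) = p"
proof -
  have "p \<in> polys_in (insert y UNIV)" by simp
  from poly_var_surj[OF this] obtain f where
    "\<And>i. coeff f i \<in> polys_in (UNIV - {y})" "p = poly f (var y)" by blast
  hence "\<exists>f. (\<forall>i. coeff f i \<in> polys_in (UNIV - {y})) \<and> p = poly f (var y)" by blast
  from someI_ex[OF this] have *: "(\<forall>i. coeff (as_poly y p) i \<in> polys_in (UNIV - {y})) \<and> p = poly (as_poly y p) (var y)"
    unfolding as_poly_def .
  show "coeff (as_poly y p) i \<in> polys_in (UNIV - {y})"
    by (rule *[THEN conjunct1, rule_format])
  show "poly (as_poly y p) (var y) = p"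
    by (rule *[THEN conjunct2, symmetric])
qed

lemma as_poly_unique:
  fixes p :: "('x, 'k::comm_ring_1) mpoly"
  assumes "\<And>i. coeff f i \<in> polys_in (UNIV - {y})" "poly f (var y) = p"
  shows "as_poly y p = f"
proof (rule poly_var_inj)
  show "coeff (as_poly y p) i \<in> polys_in (UNIV - {y})" for i by (rule as_poly(1))
  show "coeff f i \<in> polys_in (UNIV - {y})" for i by (rule assms(1))
  show "poly (as_poly y p) (var y) = poly f (var y)" by (simp only: as_poly(2) assms(2))
qed

lemma as_poly_mult:
  fixes p q :: "('x, 'k::comm_ring_1) mpoly"
  shows "as_poly y (p * q) = as_poly y p * as_poly y q"
proof (rule as_poly_unique)
  show "coeff (as_poly y p * as_poly y q) i \<in> polys_in (UNIV - {y})" for i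
    unfolding coeff_mult by (rule polys_in_sum, rule polys_in_mult) (rule as_poly(1))+
  show "poly (as_poly y p * as_poly y q) (var y) = p * q"
    by (simp only: poly_mult as_poly(2))
qed

lemma as_poly_eq_0_iff:
  fixes p :: "('x, 'k::comm_ring_1) mpoly"
  shows "as_poly y p = 0 \<longleftrightarrow> p = 0"
proof
  assume "as_poly y p = 0"
  thus "p = 0" using as_poly(2)[of y p] by (simp only: poly_0)
next
  assume "p = 0"
  thus "as_poly y p = 0" by (intro as_poly_unique) (simp_all only: poly_0 coeff_0 polys_in_zero)
qed

text \<open>Going through \<open>as_poly\<close> lets the degree in \<open>y\<close> inherit
  additivity on products from univariate polynomials over a domain.\<close>

definition var_degree :: "'x \<Rightarrow> ('x, 'k::comm_ring_1) mpoly \<Rightarrow> nat" where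
  "var_degree y p = degree (as_poly y p)"

lemma var_degree_mult:
  fixes p q :: "('x::linorder, 'k::idom) mpoly"
  assumes "p \<noteq> 0" "q \<noteq> 0"
  shows "var_degree y (p * q) = var_degree y p + var_degree y q"
  using assms by (simp add: var_degree_def as_poly_mult degree_mult_eq as_poly_eq_0_iff)

lemma var_degree_eq_0_iff:
  fixes p :: "('x, 'k::comm_ring_1) mpoly"
  shows "var_degree y p = 0 \<longleftrightarrow> p \<in> polys_in (UNIV - {y})"
proof
  assume "var_degree y p = 0"
  then obtain c where c: "as_poly y p = [:c:]"
    unfolding var_degree_def by (auto elim: degree_eq_zeroE)
  hence "p = c" using as_poly(2)[of y p] by simp
  thus "p \<in> polys_in (UNIV - {y})" using as_poly(1)[of y p 0] c by simp
next
  assume "p \<in> polys_in (UNIV - {y})"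
  hence "as_poly y p = [:p:]"
    by (intro as_poly_unique) (auto simp: coeff_pCons polys_in_zero split: nat.splits)
  thus "var_degree y p = 0" by (simp add: var_degree_def)
qed

text \<open>Membership becomes the vanishing of quantities that add up on products; this is why
  factors of a nonzero polynomial in \<open>X\<close> again involve only \<open>X\<close>.\<close>

lemma polys_in_iff_var_degree:
  fixes p :: "('x, 'k::comm_ring_1) mpoly"
  shows "p \<in> polys_in X \<longleftrightarrow> (\<forall>y. y \<notin> X \<longrightarrow> var_degree y p = 0)"
  by (auto simp: var_degree_eq_0_iff polys_in_def)

lemma polys_in_subring: "factor_closed_subring (polys_in X :: ('x::linorder, 'k::idom) mpoly set)"
proof
  fix a b :: "('x, 'k) mpoly" assume "a * b \<in> polys_in X" "a * b \<noteq> 0"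
  thus "a \<in> polys_in X" by (auto simp: polys_in_iff_var_degree var_degree_mult)
qed (auto intro: polys_in_zero polys_in_one polys_in_add polys_in_uminus polys_in_mult)

lemma unit_iff_polys_in_empty:
  fixes p :: "('x::linorder, 'k::field) mpoly"
  shows "p dvd 1 \<longleftrightarrow> p \<noteq> 0 \<and> p \<in> polys_in {}"
proof
  assume "p dvd 1"
  then obtain q where q: "p * q = 1" by (auto elim!: dvdE)
  hence "p * q \<in> polys_in {}" "p * q \<noteq> 0" using polys_in_one by simp_all
  thus "p \<noteq> 0 \<and> p \<in> polys_in {}"
    using factor_closed_subring.factor[OF polys_in_subring] by auto
next
  assume p: "p \<noteq> 0 \<and> p \<in> polys_in {}"
  hence "Poly_Mapping.keys p \<subseteq> {0}" by (auto simp: polys_in_def)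
  hence "p = Poly_Mapping.single 0 (Poly_Mapping.lookup p 0)"
    by (intro poly_mapping_eqI) (auto simp: lookup_single when_def in_keys_iff)
  moreover define c where "c = Poly_Mapping.lookup p 0"
  ultimately have c: "p = Poly_Mapping.single 0 c" "c \<noteq> 0" using p by auto
  hence "p * Poly_Mapping.single 0 (inverse c) = 1" by (simp add: mult_single)
  thus "p dvd 1" by (metis dvd_triv_left)
qed

text \<open>The sum of the degrees in all variables is additive on products and vanishes exactly on the units, so it
  is a termination measure for splitting into factors.\<close>

lemma irreducible_factorization:
  fixes p :: "('x::{finite,linorder}, 'k::field) mpoly"
  assumes "p \<noteq> 0"
  shows "\<exists>u F. u dvd 1 \<and> (\<forall>r\<in>#F. irreducible r) \<and> p = u * prod_mset F"
  using assms
proof (induction "\<Sum>y\<in>UNIV. var_degree y p" arbitrary: p rule: less_induct)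
  case less
  have smaller: "(\<Sum>y\<in>UNIV. var_degree y a) < (\<Sum>y\<in>UNIV. var_degree y p)"
    if "p = a * b" "\<not> b dvd 1" for a b
  proof -
    have nz: "a \<noteq> 0" "b \<noteq> 0" using less.prems that by auto
    then obtain y where "var_degree y b \<noteq> 0"
      using \<open>\<not> b dvd 1\<close> by (auto simp: unit_iff_polys_in_empty polys_in_iff_var_degree)
    hence "0 < (\<Sum>y\<in>UNIV. var_degree y b)" by (intro sum_pos2[of _ y]) auto
    thus ?thesis using nz by (simp add: that(1) var_degree_mult sum.distrib)
  qed
  show ?case
  proof (cases "p dvd 1 \<or> irreducible p")
    case True
    thus ?thesis
      by (metis comm_monoid_mult_class.mult_1 dvd_refl mult.right_neutral prod_mset_empty
          prod_mset_singleton empty_iff set_mset_empty set_mset_add_mset_insert singletonD)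
  next
    case False
    then obtain a b where ab: "p = a * b" "\<not> a dvd 1" "\<not> b dvd 1"
      using less.prems by (auto simp: irreducible_def)
    have nz: "a \<noteq> 0" "b \<noteq> 0" using less.prems ab by auto
    obtain u F where 1: "u dvd 1" "\<forall>r\<in>#F. irreducible r" "a = u * prod_mset F"
      using less.hyps[OF smaller nz(1)] ab by blast
    obtain v G where 2: "v dvd 1" "\<forall>r\<in>#G. irreducible r" "b = v * prod_mset G"
      using less.hyps[OF smaller nz(2), of a] ab by (metis mult.commute)
    have "p = (u * v) * prod_mset (F + G)" using ab 1 2 by (simp add: mult_ac)
    moreover have "u * v dvd 1" using mult_dvd_mono[OF 1(1) 2(1)] by simp
    moreover have "\<forall>r\<in>#F + G. irreducible r" using 1 2 by auto
    ultimately show ?thesis by blast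
  qed
qed

text \<open>Irreducibility and divisibility refer to the full ring at every stage, so adding a
  variable only enlarges the range of \<open>p\<close>, \<open>a\<close> and \<open>b\<close>. In
  the step all of them are read as univariate polynomials in \<open>y\<close>, where
  \<open>irred_imp_prime\<close> applies.\<close>

lemma irreducible_imp_relatively_prime:
  fixes p a b :: "('x::{finite,linorder}, 'k::field) mpoly"
  assumes "finite X" "irreducible p" "p \<in> polys_in X" "a \<in> polys_in X" "b \<in> polys_in X" "p dvd a * b"
  shows "p dvd a \<or> p dvd b"
  using assms
proof (induction X arbitrary: p a b rule: finite_induct)
  case empty
  hence "p dvd 1" by (auto simp: unit_iff_polys_in_empty)
  thus ?case using empty.prems by (simp add: irreducible_def)
next
  case (insert y X)
  let ?D = "polys_in X :: ('x, 'k) mpoly set"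
  let ?E = "polys_in (insert y X) :: ('x, 'k) mpoly set"
  interpret D: factor_closed_subring ?D by (rule polys_in_subring)
  interpret E: factor_closed_subring ?E by (rule polys_in_subring)
  \<comment> \<open>Factors of \<open>c\<close> that are irreducible in the full ring lie in
    \<open>?D\<close> by closure under factors, and the induction hypothesis makes them prime
    there.\<close>
  interpret relative_ufd ?D
  proof
    fix c assume c: "c \<in> ?D" "c \<noteq> 0"
    obtain u F where *: "u dvd 1" "\<forall>r\<in>#F. irreducible r" "c = u * prod_mset F"
      using irreducible_factorization[OF c(2)] by blast
    have "u \<in> ?D" using D.factor c * by blast
    moreover have "D.relprime r" if r: "r \<in># F" for r
    proof -
      obtain F' where "F = add_mset r F'" using r by (meson mset_add)
      hence "c = r * (u * prod_mset F')" using * by (simp add: mult_ac)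
      hence "r \<in> ?D" using D.factor c by blast
      thus ?thesis using * r insert.IH unfolding D.relprime_def irreducible_def
        by (meson irreducible_def)
    qed
    ultimately show "\<exists>u F. u \<in> ?D \<and> u dvd 1 \<and> (\<forall>r\<in>#F. D.relprime r) \<and> c = u * prod_mset F"
      using * by blast
  qed
  have XD: "X - {y} = X" "X \<subseteq> UNIV - {y}" using insert.hyps by auto
  have lift_ex: "\<exists>f\<in>D.polys. c = poly f (var y)" if c: "c \<in> ?E" for c
  proof -
    obtain f where "\<And>i. coeff f i \<in> polys_in (X - {y})" "c = poly f (var y)"
      by (rule poly_var_surj[OF c], rule that)
    thus ?thesis unfolding D.polys_def XD(1) by blast
  qed
  have inj: "f = g" if "f \<in> D.polys" "g \<in> D.polys" "poly f (var y) = poly g (var y)" for f g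
    by (rule poly_var_inj[of _ y]) (use that polys_in_mono[OF XD(2)] in \<open>auto simp: D.polys_def\<close>)
  obtain f where f: "f \<in> D.polys" "p = poly f (var y)" using lift_ex insert.prems by blast
  have p: "p \<noteq> 0" "\<not> p dvd 1" using insert.prems by (auto simp: irreducible_def)
  \<comment> \<open>The inverse of the value of \<open>g\<close> is a factor of 1, so it lies in
    \<open>?E\<close> and is itself a value at \<open>y\<close>; injectivity carries the equation
    back.\<close>
  have unit: "g dvd 1" if g: "g \<in> D.polys" "poly g (var y) dvd 1" for g
  proof -
    obtain w where w: "poly g (var y) * w = 1" using g by (auto elim!: dvdE)
    have "w * poly g (var y) \<in> ?E" "w * poly g (var y) \<noteq> 0"
      using w E.one by (simp_all add: mult.commute)
    hence "w \<in> ?E" by (rule E.factor)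
    then obtain w' where w': "w' \<in> D.polys" "w = poly w' (var y)" using lift_ex by blast
    have "g * w' = 1"
      by (rule inj) (use g w w' D.polys_one D.polys_mult in auto)
    thus ?thesis by (metis dvd_triv_left)
  qed
  have "irred f"
    unfolding irred_def
  proof (intro conjI ballI impI)
    show "\<not> f dvd 1"
    proof
      assume "f dvd 1"
      then obtain w where "f * w = 1" by (auto elim!: dvdE)
      hence "p * poly w (var y) = 1" using f by (metis poly_1 poly_mult)
      thus False using p by (metis dvd_triv_left)
    qed
    fix g h assume gh: "g \<in> D.polys" "h \<in> D.polys" "f = g * h"
    hence "p = poly g (var y) * poly h (var y)" using f by simp
    hence "poly g (var y) dvd 1 \<or> poly h (var y) dvd 1"
      using insert.prems by (auto simp: irreducible_def)
    thus "g dvd 1 \<or> h dvd 1" using unit gh by blast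
  qed (use f p in auto)
  obtain a' b' where ab: "a' \<in> D.polys" "a = poly a' (var y)" "b' \<in> D.polys" "b = poly b' (var y)"
    using lift_ex insert.prems by meson
  obtain c where c: "a * b = p * c" using insert.prems by (auto elim!: dvdE)
  have "p * c \<in> ?E" unfolding c[symmetric] using insert.prems by (intro E.mult)
  hence "c \<in> ?E" using E.factor' insert.prems p(1) by blast
  then obtain c' where c': "c' \<in> D.polys" "c = poly c' (var y)" using lift_ex by blast
  have "a' * b' = f * c'"
    by (rule inj) (use ab c c' f D.polys_mult in auto)
  hence "f dvd a' \<or> f dvd b'"
    using irred_imp_prime[OF \<open>irred f\<close> ab(1,3)] by simp
  thus ?case using ab f by (auto elim!: dvdE)
qed

lemma irreducible_imp_prime_elem_mpoly:
  fixes p :: "('x::{finite,linorder}, 'k::field) mpoly"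
  assumes "irreducible p"
  shows "prime_elem p"
  using assms irreducible_imp_relatively_prime[of UNIV p]
  by (auto simp: prime_elem_def irreducible_def)

section \<open>Products of the chosen irreducible factors\<close>

lemma prime_elem_dvd_prod_mset:
  fixes r :: "'a::idom"
  assumes "prime_elem r" "r dvd prod_mset G"
  shows "\<exists>s\<in>#G. r dvd s"
  using assms(2)
proof (induction G)
  case empty
  thus ?case using assms(1) by (simp add: prime_elem_def)
next
  case (add s G)
  hence "r dvd s \<or> r dvd prod_mset G" using assms(1) by (simp add: prime_elem_def)
  thus ?case using add.IH by auto
qed

text \<open>A prime \<open>r\<close> of \<open>F\<close> divides some member of \<open>G\<close> and
  then equals it, as divisibility between representatives is equality; cancelling \<open>r\<close>
  on both sides takes care of multiplicities.\<close>

lemma prod_mset_reps_dvd_imp_subset: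
  fixes F G :: "'a::idom multiset"
  assumes "prod_mset F dvd prod_mset G" "set_mset F \<subseteq> R" "set_mset G \<subseteq> R"
    and "\<And>r. r \<in> R \<Longrightarrow> prime_elem r" and "\<And>r s. r \<in> R \<Longrightarrow> s \<in> R \<Longrightarrow> r dvd s \<Longrightarrow> r = s"
  shows "F \<subseteq># G"
  using assms(1-3)
proof (induction F arbitrary: G)
  case (add r F)
  have r: "r \<in> R" "prime_elem r" using add.prems assms(4) by auto
  have "r dvd prod_mset G" using add.prems(1) by (simp add: dvd_mult_left)
  then obtain s where "s \<in># G" "r dvd s" using prime_elem_dvd_prod_mset[OF r(2)] by blast
  hence "r \<in># G" using assms(5)[of r s] r add.prems by auto
  then obtain G' where G': "G = add_mset r G'" by (meson mset_add)
  hence "prod_mset F dvd prod_mset G'"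
    using add.prems r(2) by (simp add: prime_elem_def)
  thus ?case using add.IH[of G'] add.prems G' by simp
qed simp

lemma normalized_lcm_unique:
  fixes q q' :: "('x::{finite,linorder}, 'k::field) mpoly"
  assumes R: "irreducible_factor_reps A R"
    and "normalized_lcm R X q" "normalized_lcm R Y q'" and "q dvd q'" "q' dvd q"
  shows "q = q'"
proof -
  obtain F G where F: "set_mset F \<subseteq> R" "q = prod_mset F" and G: "set_mset G \<subseteq> R" "q' = prod_mset G"
    using assms(2,3) by (auto simp: normalized_lcm_def)
  have irr: "irreducible r" if "r \<in> R" for r
    using R that by (simp add: irreducible_factor_reps_def)
  \<comment> \<open>An irreducible dividing an irreducible is associated to it, and \<open>R\<close>
    contains exactly one associate of each irreducible factor.\<close>
  have eq: "r = s" if rs: "r \<in> R" "s \<in> R" "r dvd s" for r s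
  proof -
    obtain k where k: "s = r * k" using rs(3) by (auto elim!: dvdE)
    hence "r dvd 1 \<or> k dvd 1" using irr[OF rs(2)] by (auto simp: irreducible_def)
    hence "k dvd 1" using irr[OF rs(1)] by (auto simp: irreducible_def)
    then obtain w where w: "k * w = 1" by (auto elim!: dvdE)
    have "r = s * w" using w by (simp add: k mult.assoc)
    hence "s dvd r" by simp
    moreover obtain a where "a \<in> A" "s dvd a" 
      using R rs by (auto simp: irreducible_factor_reps_def)
    ultimately show ?thesis
      using R irr[OF rs(2)] rs unfolding irreducible_factor_reps_def by (metis dvd_refl)
  qed
  have "F \<subseteq># G" "G \<subseteq># F"
    using prod_mset_reps_dvd_imp_subset[of F G R] prod_mset_reps_dvd_imp_subset[of G F R]
      irr irreducible_imp_prime_elem_mpoly eq F G assms(4,5) by blast+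
  hence "F = G" by (rule subset_mset.antisym)
  thus ?thesis using F G by simp
qed

lemma normalized_lcm_nonzero:
  fixes q :: "'a::idom"
  assumes "irreducible_factor_reps A R" "normalized_lcm R X q"
  shows "q \<noteq> 0"
proof -
  obtain F where F: "set_mset F \<subseteq> R" "q = prod_mset F"
    using assms by (auto simp: normalized_lcm_def)
  moreover have "0 \<notin> R" using assms by (auto simp: irreducible_factor_reps_def)
  ultimately show ?thesis by (auto simp: prod_mset_zero_iff)
qed

section \<open>Scarf faces and the map f\<close>

interpretation smul: module "smul :: 'r::comm_ring_1 \<Rightarrow> ('b \<Rightarrow>\<^sub>0 'r) \<Rightarrow> ('b \<Rightarrow>\<^sub>0 'r)"
  by (rule module_smul)

text \<open>The range \<open>A\<close> may exceed the support, so that differentials of chains with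
  different supports become sums over one set and can be compared term by term.\<close>

lemma lookup_diff:
  assumes "finite A" "Poly_Mapping.keys c \<subseteq> A"
  shows "Poly_Mapping.lookup (diff c) t =
    (\<Sum>s\<in>A. Poly_Mapping.lookup c s * Poly_Mapping.lookup (diff_basis s) t)"
  unfolding diff_def lookup_sum lookup_smul
  by (rule sum.mono_neutral_left) (use assms in \<open>auto simp: in_keys_iff\<close>)

lemma lookup_taylor_diff:
  assumes "finite A" "Poly_Mapping.keys c \<subseteq> A"
  shows "Poly_Mapping.lookup (taylor_diff L c) t =
    (\<Sum>s\<in>A. Poly_Mapping.lookup c s * Poly_Mapping.lookup (taylor_diff_basis L s) t)"
  unfolding taylor_diff_def lookup_sum lookup_smul
  by (rule sum.mono_neutral_left) (use assms in \<open>auto simp: in_keys_iff\<close>)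

lemma diff_add: "diff (a + b) = diff a + diff b"
proof (rule poly_mapping_eqI)
  fix t
  let ?A = "Poly_Mapping.keys a \<union> Poly_Mapping.keys b"
  have "Poly_Mapping.keys (a + b) \<subseteq> ?A" by (rule keys_add)
  thus "Poly_Mapping.lookup (diff (a + b)) t = Poly_Mapping.lookup (diff a + diff b) t"
    by (simp add: lookup_diff[of ?A] lookup_add distrib_right sum.distrib)
qed

lemma taylor_diff_minus: "taylor_diff L (a - b) = taylor_diff L a - taylor_diff L b"
proof (rule poly_mapping_eqI)
  fix t
  let ?A = "Poly_Mapping.keys a \<union> Poly_Mapping.keys b"
  have "Poly_Mapping.keys (a - b) \<subseteq> ?A" by (rule keys_diff)
  thus "Poly_Mapping.lookup (taylor_diff L (a - b)) t =
      Poly_Mapping.lookup (taylor_diff L a - taylor_diff L b) t"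
    by (simp add: lookup_taylor_diff[of ?A] lookup_minus left_diff_distrib sum_subtractf)
qed

lemma diff_basis_nonzeroD:
  assumes "Poly_Mapping.lookup (diff_basis s) t \<noteq> (0::'k::comm_ring_1)"
  shows "\<exists>i\<in>s. t = s - {i}"
proof (rule ccontr)
  assume "\<not> ?thesis"
  hence "Poly_Mapping.lookup (diff_basis s) t = (0::'k)"
    unfolding diff_basis_def lookup_sum by (intro sum.neutral) (auto simp: lookup_single when_def)
  thus False using assms by simp
qed

lemma lookup_taylor_diff_basis:
  "Poly_Mapping.lookup (taylor_diff_basis L s) t = Poly_Mapping.lookup (diff_basis s) t * quot (L s) (L t)"
  unfolding taylor_diff_basis_def diff_basis_def lookup_sum sum_distrib_right
  by (rule sum.cong) (auto simp: lookup_single when_def)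

lemma diff_nonzeroD:
  fixes c :: "nat set \<Rightarrow>\<^sub>0 'k::comm_ring_1"
  assumes "Poly_Mapping.lookup (diff c) t \<noteq> 0"
  shows "\<exists>s\<in>Poly_Mapping.keys c. \<exists>i\<in>s. t = s - {i}"
proof -
  obtain s where "s \<in> Poly_Mapping.keys c"
    and "Poly_Mapping.lookup c s * Poly_Mapping.lookup (diff_basis s) t \<noteq> 0"
    using assms unfolding lookup_diff[OF finite_keys order_refl] by (rule sum.not_neutral_contains_not_neutral)
  moreover from this(2) have "Poly_Mapping.lookup (diff_basis s) t \<noteq> (0::'k)" by auto
  ultimately show ?thesis using diff_basis_nonzeroD by blast
qed

lemma taylor_diff_nonzeroD:
  fixes c :: "nat set \<Rightarrow>\<^sub>0 'r::comm_ring_1"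
  assumes "Poly_Mapping.lookup (taylor_diff L c) t \<noteq> 0"
  shows "\<exists>s\<in>Poly_Mapping.keys c. \<exists>i\<in>s. t = s - {i}"
proof -
  obtain s where "s \<in> Poly_Mapping.keys c"
    and "Poly_Mapping.lookup c s * Poly_Mapping.lookup (taylor_diff_basis L s) t \<noteq> 0"
    using assms unfolding lookup_taylor_diff[OF finite_keys order_refl]
    by (rule sum.not_neutral_contains_not_neutral)
  moreover from this(2) have "Poly_Mapping.lookup (diff_basis s) t \<noteq> (0::'r)"
    by (auto simp: lookup_taylor_diff_basis)
  ultimately show ?thesis using diff_basis_nonzeroD by blast
qed

lemma subspace_set_sum:
  fixes U W :: "('b \<Rightarrow>\<^sub>0 'r::comm_ring_1) set"
  assumes "smul.subspace U" "smul.subspace W"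
  shows "smul.subspace {u + w | u w. u \<in> U \<and> w \<in> W}"
proof (rule smul.subspaceI)
  show "0 \<in> {u + w | u w. u \<in> U \<and> w \<in> W}"
    using smul.subspace_0[OF assms(1)] smul.subspace_0[OF assms(2)] by force
next
  fix x y assume "x \<in> {u + w | u w. u \<in> U \<and> w \<in> W}" "y \<in> {u + w | u w. u \<in> U \<and> w \<in> W}"
  then obtain u w u' w' where "x = u + w" "y = u' + w'" "u \<in> U" "w \<in> W" "u' \<in> U" "w' \<in> W"
    by blast
  moreover from this have "x + y = (u + u') + (w + w')" by simp
  ultimately show "x + y \<in> {u + w | u w. u \<in> U \<and> w \<in> W}"
    using smul.subspace_add[OF assms(1)] smul.subspace_add[OF assms(2)] by blast
next
  fix r x assume "x \<in> {u + w | u w. u \<in> U \<and> w \<in> W}"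
  then obtain u w where "x = u + w" "u \<in> U" "w \<in> W" by blast
  thus "smul r x \<in> {u + w | u w. u \<in> U \<and> w \<in> W}"
    using smul.subspace_scale[OF assms(1), of u r] smul.subspace_scale[OF assms(2), of w r]
      smul.scale_right_distrib[of r u w] by blast
qed

lemma finite_fiber: "finite (fiber m L q)"
  unfolding fiber_def by (rule finite_subset[of _ "Pow {1..m}"]) auto

lemma lookup_projQ:
  "Poly_Mapping.lookup (projQ m L q c) s = (if s \<in> fiber m L q then Poly_Mapping.lookup c s else 0)"
  by (simp add: projQ_def lookup_sum lookup_single when_def finite_fiber sum.delta)

lemma smul_single: "smul r (Poly_Mapping.single s x) = Poly_Mapping.single s (r * x)"
  by (rule poly_mapping_eqI) (simp add: lookup_smul lookup_single when_def)

lemma smul_sum_single: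
  "c = (\<Sum>s\<in>Poly_Mapping.keys c. smul (Poly_Mapping.lookup c s) (Poly_Mapping.single s 1))"
  by (rule poly_mapping_eqI)
    (simp add: smul_single lookup_sum lookup_single when_def sum.delta in_keys_iff)

definition scarf_faces :: "nat \<Rightarrow> (nat set \<Rightarrow> 'r) \<Rightarrow> nat set set" where
  "scarf_faces m L = {s. s \<subseteq> {1..m} \<and> card (fiber m L (L s)) = 1}"

lemma scarf_face_fiber:
  assumes "s \<in> scarf_faces m L"
  shows "fiber m L (L s) = {s}"
proof -
  obtain x where "fiber m L (L s) = {x}"
    using assms by (auto simp: scarf_faces_def card_1_singleton_iff)
  moreover have "s \<in> fiber m L (L s)" using assms by (auto simp: scarf_faces_def fiber_def)
  ultimately show ?thesis by auto
qed

lemma keys_smul: "Poly_Mapping.keys (smul r c) \<subseteq> Poly_Mapping.keys c"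
  by (auto simp: in_keys_iff lookup_smul)

lemma scarf_complex_iff:
  fixes c :: "nat set \<Rightarrow>\<^sub>0 'r::comm_ring_1"
  shows "c \<in> scarf_complex m L \<longleftrightarrow> Poly_Mapping.keys c \<subseteq> scarf_faces m L"
proof
  let ?W = "{c :: nat set \<Rightarrow>\<^sub>0 'r. Poly_Mapping.keys c \<subseteq> scarf_faces m L}"
  have "smul.subspace ?W"
  proof (rule smul.subspaceI)
    fix x y assume "x \<in> ?W" "y \<in> ?W"
    thus "x + y \<in> ?W" using keys_add[of x y] by blast
  next
    fix r x assume "x \<in> ?W"
    thus "smul r x \<in> ?W" using keys_smul[of r x] by blast
  qed simp
  moreover have "{Poly_Mapping.single s 1 | s. s \<subseteq> {1..m} \<and> card (fiber m L (L s)) = 1} \<subseteq> ?W"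
    by (auto simp: scarf_faces_def split: if_splits)
  ultimately have "scarf_complex m L \<subseteq> ?W"
    unfolding scarf_complex_def by (intro smul.span_minimal)
  thus "c \<in> scarf_complex m L \<Longrightarrow> Poly_Mapping.keys c \<subseteq> scarf_faces m L" by blast
next
  assume c: "Poly_Mapping.keys c \<subseteq> scarf_faces m L"
  have "(\<Sum>s\<in>Poly_Mapping.keys c. smul (Poly_Mapping.lookup c s) (Poly_Mapping.single s 1)) \<in> scarf_complex m L"
    unfolding scarf_complex_def
    by (intro smul.span_sum smul.span_scale smul.span_base) (use c in \<open>auto simp: scarf_faces_def\<close>)
  thus "c \<in> scarf_complex m L" by (simp flip: smul_sum_single)
qed

text \<open>Unlike \<open>projQ\<close> this also cuts out a single cardinality, since
  \<open>H\<close> and \<open>B'\<close> are prescribed separately in each degree.\<close>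

definition part :: "nat \<Rightarrow> (nat set \<Rightarrow> 'r) \<Rightarrow> 'r \<Rightarrow> nat \<Rightarrow> (nat set \<Rightarrow>\<^sub>0 'k::comm_ring_1) \<Rightarrow> (nat set \<Rightarrow>\<^sub>0 'k)" where
  "part m L q p c = (\<Sum>s\<in>{s \<in> fiber m L q. card s = p}. Poly_Mapping.single s (Poly_Mapping.lookup c s))"

lemma lookup_part:
  "Poly_Mapping.lookup (part m L q p c) s =
     (if s \<in> fiber m L q \<and> card s = p then Poly_Mapping.lookup c s else 0)"
  by (simp add: part_def lookup_sum lookup_single when_def finite_fiber sum.delta)

lemma KQ_keysD:
  "c \<in> KQ m L q p \<Longrightarrow> s \<in> Poly_Mapping.keys c \<Longrightarrow> s \<in> fiber m L q \<and> card s = p \<and> s \<subseteq> {1..m}"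
  by (auto simp: KQ_def chains_def)

lemma KQ_iff: "c \<in> KQ m L q p \<longleftrightarrow> Poly_Mapping.keys c \<subseteq> {s \<in> fiber m L q. card s = p}"
  by (auto simp: KQ_def chains_def fiber_def)

lemma part_add: "part m L q p (a + b) = part m L q p a + part m L q p b"
  by (rule poly_mapping_eqI) (simp add: lookup_part lookup_add)

lemma part_smul: "part m L q p (smul r a) = smul r (part m L q p a)"
  by (rule poly_mapping_eqI) (simp add: lookup_part lookup_smul)

lemma part_zero: "part m L q p 0 = 0"
  by (rule poly_mapping_eqI) (simp add: lookup_part)

lemma part_KQ:
  assumes "c \<in> KQ m L r i"
  shows "part m L q j c = (if q = r \<and> j = i then c else 0)"
proof (rule poly_mapping_eqI)
  fix s
  show "Poly_Mapping.lookup (part m L q j c) s = Poly_Mapping.lookup (if q = r \<and> j = i then c else 0) s"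
    using KQ_keysD[OF assms, of s] by (cases "s \<in> Poly_Mapping.keys c") (auto simp: lookup_part in_keys_iff fiber_def)
qed

context
  fixes m :: nat and L :: "nat set \<Rightarrow> 'r"
    and H B' :: "'r \<Rightarrow> nat \<Rightarrow> (nat set \<Rightarrow>\<^sub>0 'k::comm_ring_1) set"
  assumes spl: "splitting m L H B'"
begin

lemma splittingD:
  assumes "q \<in> lcm_lattice m L"
  shows "smul.subspace (H q p)" "smul.subspace (B' q p)"
    "smul.subspace (boundariesQ m L q p :: (nat set \<Rightarrow>\<^sub>0 'k) set)" "smul.subspace (cyclesQ m L q p :: (nat set \<Rightarrow>\<^sub>0 'k) set)"
    "H q p \<subseteq> cyclesQ m L q p" "(boundariesQ m L q p :: (nat set \<Rightarrow>\<^sub>0 'k) set) \<subseteq> cyclesQ m L q p"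
    "(cyclesQ m L q p :: (nat set \<Rightarrow>\<^sub>0 'k) set) \<subseteq> KQ m L q p" "B' q p \<subseteq> KQ m L q p"
    "boundariesQ m L q p \<inter> H q p = {0}" "cyclesQ m L q p \<inter> B' q p = {0}"
    "cyclesQ m L q p = {u + w | u w. u \<in> boundariesQ m L q p \<and> w \<in> H q p}"
proof -
  have 1: "direct_sum_of (cyclesQ m L q p) (boundariesQ m L q p) (H q p)"
    and 2: "direct_sum_of (KQ m L q p) (cyclesQ m L q p) (B' q p)"
    using spl assms by (auto simp: splitting_def)
  note d1 = 1[unfolded direct_sum_of_def] and d2 = 2[unfolded direct_sum_of_def]
  show sH: "smul.subspace (H q p)" by (rule d1[THEN conjunct2, THEN conjunct1])
  show sB': "smul.subspace (B' q p)" by (rule d2[THEN conjunct2, THEN conjunct1])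
  show sB: "smul.subspace (boundariesQ m L q p :: (nat set \<Rightarrow>\<^sub>0 'k) set)" by (rule d1[THEN conjunct1])
  show sZ: "smul.subspace (cyclesQ m L q p :: (nat set \<Rightarrow>\<^sub>0 'k) set)" by (rule d2[THEN conjunct1])
  show "boundariesQ m L q p \<inter> H q p = {0}"
    by (rule d1[THEN conjunct2, THEN conjunct2, THEN conjunct2])
  show "cyclesQ m L q p \<inter> B' q p = {0}"
    by (rule d2[THEN conjunct2, THEN conjunct2, THEN conjunct2])
  show c: "cyclesQ m L q p = {u + w | u w. u \<in> boundariesQ m L q p \<and> w \<in> H q p}"
    by (rule d1[THEN conjunct2, THEN conjunct2, THEN conjunct1])
  have K: "KQ m L q p = {u + w | u w. u \<in> cyclesQ m L q p \<and> w \<in> B' q p}"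
    by (rule d2[THEN conjunct2, THEN conjunct2, THEN conjunct1])
  have left: "U \<subseteq> {u + w | u w. u \<in> U \<and> w \<in> W}" and right: "W \<subseteq> {u + w | u w. u \<in> U \<and> w \<in> W}"
    if "smul.subspace U" "smul.subspace W" for U W :: "(nat set \<Rightarrow>\<^sub>0 'k) set"
  proof -
    have "u + 0 \<in> {u + w | u w. u \<in> U \<and> w \<in> W}" if "u \<in> U" for u
      using that smul.subspace_0[OF \<open>smul.subspace W\<close>] by blast
    thus "U \<subseteq> {u + w | u w. u \<in> U \<and> w \<in> W}" unfolding add_0_right by blast
    have "0 + w \<in> {u + w | u w. u \<in> U \<and> w \<in> W}" if "w \<in> W" for w
      using that smul.subspace_0[OF \<open>smul.subspace U\<close>] by blast
    thus "W \<subseteq> {u + w | u w. u \<in> U \<and> w \<in> W}" unfolding add_0_left by blast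
  qed
  show "H q p \<subseteq> cyclesQ m L q p" unfolding c by (rule right[OF sB sH])
  show "(boundariesQ m L q p :: (nat set \<Rightarrow>\<^sub>0 'k) set) \<subseteq> cyclesQ m L q p" unfolding c by (rule left[OF sB sH])
  show "(cyclesQ m L q p :: (nat set \<Rightarrow>\<^sub>0 'k) set) \<subseteq> KQ m L q p" unfolding K by (rule left[OF sZ sB'])
  show "B' q p \<subseteq> KQ m L q p" unfolding K by (rule right[OF sZ sB'])
qed

text \<open>Chains all of whose components lie in the prescribed spaces form a submodule, and a
  generator has at most one nonzero component; this is the directness of the sum over the
  lattice.\<close>

lemma span_B'_parts:
  assumes "b \<in> smul.span (\<Union>q\<in>lcm_lattice m L. B' q p)"
  shows "b \<in> chains m p \<and> (\<forall>q\<in>lcm_lattice m L. part m L q p b \<in> B' q p)"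
proof -
  let ?W = "{b. b \<in> chains m p \<and> (\<forall>q\<in>lcm_lattice m L. part m L q p b \<in> B' q p)}"
  have "smul.subspace ?W"
  proof (rule smul.subspaceI)
    show "0 \<in> ?W"
    proof (intro CollectI conjI ballI)
      show "part m L q p 0 \<in> B' q p" if "q \<in> lcm_lattice m L" for q
        unfolding part_zero by (rule smul.subspace_0[OF splittingD(2)[OF that]])
    qed (simp add: chains_def)
  next
    fix x y assume xy: "x \<in> ?W" "y \<in> ?W"
    show "x + y \<in> ?W"
    proof (intro CollectI conjI ballI)
      show "x + y \<in> chains m p" using xy keys_add[of x y] unfolding chains_def by blast
      fix q assume q: "q \<in> lcm_lattice m L"
      hence "part m L q p x \<in> B' q p" "part m L q p y \<in> B' q p" using xy by blast+
      thus "part m L q p (x + y) \<in> B' q p"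
        unfolding part_add by (rule smul.subspace_add[OF splittingD(2)[OF q]])
    qed
  next
    fix r x assume x: "x \<in> ?W"
    show "smul r x \<in> ?W"
    proof (intro CollectI conjI ballI)
      show "smul r x \<in> chains m p" using x keys_smul[of r x] unfolding chains_def by blast
      fix q assume q: "q \<in> lcm_lattice m L"
      hence "part m L q p x \<in> B' q p" using x by blast
      thus "part m L q p (smul r x) \<in> B' q p"
        unfolding part_smul by (rule smul.subspace_scale[OF splittingD(2)[OF q]])
    qed
  qed
  moreover have "(\<Union>q\<in>lcm_lattice m L. B' q p) \<subseteq> ?W"
  proof safe
    fix r c assume r: "r \<in> lcm_lattice m L" and c: "c \<in> B' r p"
    hence K: "c \<in> KQ m L r p" using splittingD(8) by blast
    thus "c \<in> chains m p" by (simp add: KQ_def)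
    fix q assume "q \<in> lcm_lattice m L"
    thus "part m L q p c \<in> B' q p"
      using c smul.subspace_0[OF splittingD(2), of q p] by (simp add: part_KQ[OF K])
  qed
  ultimately have "smul.span (\<Union>q\<in>lcm_lattice m L. B' q p) \<subseteq> ?W"
    by (intro smul.span_minimal)
  thus ?thesis using assms by blast
qed

lemma span_HB'_parts:
  assumes "z \<in> smul.span (\<Union>q\<in>lcm_lattice m L. \<Union>j. H q j \<union> B' q j)" and "q \<in> lcm_lattice m L"
  shows "part m L q j z \<in> {h + b | h b. h \<in> H q j \<and> b \<in> B' q j}"
proof -
  let ?S = "\<lambda>q j. {h + b | h b. h \<in> H q j \<and> b \<in> B' q j}"
  have sub: "smul.subspace (?S q j)" if "q \<in> lcm_lattice m L" for q j
    using subspace_set_sum[OF splittingD(1)[OF that] splittingD(2)[OF that]] .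
  let ?W = "{z. \<forall>q\<in>lcm_lattice m L. \<forall>j. part m L q j z \<in> ?S q j}"
  have "smul.subspace ?W"
  proof (rule smul.subspaceI)
    show "0 \<in> ?W"
    proof (rule CollectI, intro ballI allI)
      show "part m L q j 0 \<in> ?S q j" if "q \<in> lcm_lattice m L" for q j
        unfolding part_zero by (rule smul.subspace_0[OF sub[OF that]])
    qed
  next
    fix x y assume xy: "x \<in> ?W" "y \<in> ?W"
    show "x + y \<in> ?W"
    proof (rule CollectI, intro ballI allI)
      fix q j assume q: "q \<in> lcm_lattice m L"
      hence "part m L q j x \<in> ?S q j" "part m L q j y \<in> ?S q j" using xy by blast+
      thus "part m L q j (x + y) \<in> ?S q j"
        unfolding part_add by (rule smul.subspace_add[OF sub[OF q]])
    qed
  next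
    fix r x assume x: "x \<in> ?W"
    show "smul r x \<in> ?W"
    proof (rule CollectI, intro ballI allI)
      fix q j assume q: "q \<in> lcm_lattice m L"
      hence "part m L q j x \<in> ?S q j" using x by blast
      thus "part m L q j (smul r x) \<in> ?S q j"
        unfolding part_smul by (rule smul.subspace_scale[OF sub[OF q]])
    qed
  qed
  moreover have "(\<Union>q\<in>lcm_lattice m L. \<Union>j. H q j \<union> B' q j) \<subseteq> ?W"
  proof (rule subsetI, rule CollectI, intro ballI allI)
    fix c q j assume "c \<in> (\<Union>q\<in>lcm_lattice m L. \<Union>j. H q j \<union> B' q j)" and q: "q \<in> lcm_lattice m L"
    then obtain r i where r: "r \<in> lcm_lattice m L" "c \<in> H r i \<or> c \<in> B' r i" by blast
    hence K: "c \<in> KQ m L r i" using splittingD(5,7,8) by blast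
    have "c \<in> ?S r i"
      using r(2) smul.subspace_0[OF splittingD(1)[OF r(1)]] smul.subspace_0[OF splittingD(2)[OF r(1)]]
      by force
    moreover have "0 \<in> ?S q j" using smul.subspace_0[OF sub[OF q]] .
    ultimately show "part m L q j c \<in> ?S q j"
      unfolding part_KQ[OF K] by (simp only: split: if_split) blast
  qed
  ultimately have "smul.span (\<Union>q\<in>lcm_lattice m L. \<Union>j. H q j \<union> B' q j) \<subseteq> ?W"
    by (intro smul.span_minimal)
  thus ?thesis using assms by blast
qed

end

text \<open>What the combinatorial part knows about labels: the universal property of the least
  common multiple, and that it is nonzero. Factoriality enters through \<open>lcm_antisym\<close>,
  by which associated labels are equal.\<close>

locale lcm_family =
  fixes m :: nat and Q :: "nat \<Rightarrow> 'r::idom" and L :: "nat set \<Rightarrow> 'r"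
  assumes lcm_dvd_iff: "s \<subseteq> {1..m} \<Longrightarrow> L s dvd q \<longleftrightarrow> (\<forall>i\<in>s. Q i dvd q)"
    and lcm_antisym: "s \<subseteq> {1..m} \<Longrightarrow> t \<subseteq> {1..m} \<Longrightarrow> L s dvd L t \<Longrightarrow> L t dvd L s \<Longrightarrow> L s = L t"
    and lcm_nonzero: "s \<subseteq> {1..m} \<Longrightarrow> L s \<noteq> 0"
begin

lemma dvd_lcm: "s \<subseteq> {1..m} \<Longrightarrow> i \<in> s \<Longrightarrow> Q i dvd L s"
  using lcm_dvd_iff[of s "L s"] by simp

lemma lcm_mono: "s \<subseteq> {1..m} \<Longrightarrow> t \<subseteq> s \<Longrightarrow> L t dvd L s"
  using dvd_lcm lcm_dvd_iff[of t "L s"] by blast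

text \<open>If \<open>L r = L t\<close> with \<open>t \<subseteq> s\<close>, then \<open>r \<union> (s - t)\<close> has the label of \<open>s\<close> and so equals \<open>s\<close>, whence
  \<open>t \<subseteq> r \<subseteq> s\<close>; an element of \<open>r - t\<close> could be dropped from \<open>s\<close> without changing its label.\<close>

lemma scarf_face_subset:
  assumes s: "s \<in> scarf_faces m L" and "t \<subseteq> s"
  shows "t \<in> scarf_faces m L"
proof -
  have sm: "s \<subseteq> {1..m}" using s by (simp add: scarf_faces_def)
  have tm: "t \<subseteq> {1..m}" using assms(2) sm by blast
  have only_s: "u = s" if "u \<subseteq> {1..m}" "L u = L s" for u
    using scarf_face_fiber[OF s] that by (auto simp: fiber_def)
  have "r = t" if r: "r \<subseteq> {1..m}" "L r = L t" for r
  proof -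
    let ?u = "r \<union> (s - t)"
    have um: "?u \<subseteq> {1..m}" using r sm by blast
    have ru: "L r dvd L ?u" by (rule lcm_mono[OF um]) blast
    have "Q i dvd L ?u" if "i \<in> s" for i
    proof (cases "i \<in> t")
      case True
      thus ?thesis using dvd_lcm[OF tm] ru r dvd_trans by metis
    next
      case False
      thus ?thesis using dvd_lcm[OF um, of i] that by blast
    qed
    hence "L s dvd L ?u" using lcm_dvd_iff[OF sm] by blast
    moreover have "Q i dvd L s" if "i \<in> ?u" for i
    proof (cases "i \<in> r")
      case True
      thus ?thesis using dvd_lcm[OF r(1)] lcm_mono[OF sm assms(2)] r(2) dvd_trans by metis
    next
      case False
      thus ?thesis using dvd_lcm[OF sm, of i] that by blast
    qed
    hence "L ?u dvd L s" using lcm_dvd_iff[OF um] by blast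
    ultimately have "L ?u = L s" using lcm_antisym[OF um sm] by blast
    hence u: "?u = s" using only_s[OF um] by blast
    hence "t \<subseteq> r" using assms(2) by blast
    moreover have "r \<subseteq> t"
    proof
      fix x assume x: "x \<in> r"
      show "x \<in> t"
      proof (rule ccontr)
        assume "x \<notin> t"
        hence "t \<subseteq> s - {x}" using assms(2) by blast
        have xs: "x \<in> s" using x u by blast
        have sx: "s - {x} \<subseteq> {1..m}" using sm by blast
        have "L t dvd L (s - {x})" by (rule lcm_mono[OF sx]) fact
        hence "Q x dvd L (s - {x})" using dvd_lcm[OF r(1) x] r(2) dvd_trans by metis
        hence "\<forall>i\<in>s. Q i dvd L (s - {x})" using dvd_lcm[OF sx] by blast
        hence "L s dvd L (s - {x})" using lcm_dvd_iff[OF sm] by blast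
        moreover have "L (s - {x}) dvd L s" by (rule lcm_mono[OF sm]) blast
        ultimately have "L (s - {x}) = L s" using lcm_antisym[OF sx sm] by blast
        hence "s - {x} = s" using only_s[OF sx] by blast
        thus False using xs by blast
      qed
    qed
    ultimately show ?thesis by blast
  qed
  hence "fiber m L (L t) = {t}" using tm by (auto simp: fiber_def)
  thus ?thesis using tm by (simp add: scarf_faces_def)
qed

text \<open>A label is picked that is maximal for divisibility; \<open>lcm_antisym\<close> puts any
  member whose label is a multiple of it into the same fiber.\<close>

lemma keys_maximal_label:
  assumes "finite A" "A \<noteq> {}" "A \<subseteq> Pow {1..m}"
  obtains s where "s \<in> A" "\<And>t. t \<in> A \<Longrightarrow> L s dvd L t \<Longrightarrow> L t = L s"
proof -
  have "\<exists>q\<in>L ` A. \<forall>x\<in>L ` A. x \<noteq> q \<longrightarrow> \<not> proper_dvd q x"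
    by (rule Finite_Set.bex_max_element)
      (use assms in \<open>auto simp: proper_dvd_def asymp_on_def transp_on_def intro: dvd_trans\<close>)
  then obtain s where s: "s \<in> A" "\<And>t. t \<in> A \<Longrightarrow> L t \<noteq> L s \<Longrightarrow> \<not> proper_dvd (L s) (L t)"
    by blast
  have "L t = L s" if "t \<in> A" "L s dvd L t" for t
    using s that assms(3) lcm_antisym[of s t] unfolding proper_dvd_def by (metis PowD subsetD)
  thus ?thesis using that s by blast
qed

text \<open>This is the uniqueness of \<open>f(a)\<close>: the component of \<open>diff b\<close> in a maximal degree of \<open>b\<close> is a boundary of \<open>K(q)\<close>,
  and boundaries meet \<open>H' + B'\<close> only in 0.\<close>

lemma B'_chain_eq_0:
  fixes H B' :: "'r \<Rightarrow> nat \<Rightarrow> (nat set \<Rightarrow>\<^sub>0 'k::comm_ring_1) set"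
  assumes spl: "splitting m L H B'"
    and b: "b \<in> smul.span (\<Union>q\<in>lcm_lattice m L. B' q p)"
    and db: "diff b \<in> smul.span (\<Union>q\<in>lcm_lattice m L. \<Union>j. H q j \<union> B' q j)"
  shows "b = 0"
proof (rule ccontr)
  assume "b \<noteq> 0"
  have bch: "Poly_Mapping.keys b \<subseteq> {s. s \<subseteq> {1..m} \<and> card s = p}"
    using span_B'_parts[OF spl b] by (simp add: chains_def)
  obtain s where s: "s \<in> Poly_Mapping.keys b"
    and max: "\<And>t. t \<in> Poly_Mapping.keys b \<Longrightarrow> L s dvd L t \<Longrightarrow> L t = L s"
    by (rule keys_maximal_label[of "Poly_Mapping.keys b"]) (use \<open>b \<noteq> 0\<close> bch in auto)
  define q where "q = L s"
  define c where "c = part m L q p b"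
  define z where "z = diffQ m L q c"
  have q: "q \<in> lcm_lattice m L" using s bch by (auto simp: q_def lcm_lattice_def)
  note sp = splittingD[OF spl q]
  have cB: "c \<in> B' q p" using span_B'_parts[OF spl b] q by (simp add: c_def)
  hence cK: "c \<in> KQ m L q p" using sp(8) by blast
  have "s \<in> fiber m L q" "card s = p" using s bch by (auto simp: q_def fiber_def)
  hence "Poly_Mapping.lookup c s \<noteq> 0" using s by (simp add: c_def lookup_part in_keys_iff)
  hence "c \<noteq> 0" by auto
  have kc: "Poly_Mapping.keys c \<subseteq> Poly_Mapping.keys b"
    by (auto simp: c_def in_keys_iff lookup_part split: if_splits)
  \<comment> \<open>A face \<open>r\<close> of \<open>b\<close> that contributes to \<open>t\<close>
    contains \<open>t\<close>, so its label is a multiple of \<open>q\<close> and by maximality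
    \<open>q\<close> itself. Faces of \<open>b\<close> outside the fiber therefore contribute
    nothing.\<close>
  have same: "Poly_Mapping.lookup (diff c) t = Poly_Mapping.lookup (diff b) t" if t: "t \<in> fiber m L q" for t
    unfolding lookup_diff[OF finite_keys kc] lookup_diff[OF finite_keys order_refl[of "Poly_Mapping.keys b"]]
  proof (rule sum.cong)
    fix r assume r: "r \<in> Poly_Mapping.keys b"
    show "Poly_Mapping.lookup c r * Poly_Mapping.lookup (diff_basis r) t =
        Poly_Mapping.lookup b r * Poly_Mapping.lookup (diff_basis r) t"
    proof (cases "Poly_Mapping.lookup (diff_basis r) t = (0::'k)")
      case False
      then obtain i where "i \<in> r" "t = r - {i}" using diff_basis_nonzeroD by blast
      hence "L t dvd L r" using lcm_mono[of r t] r bch by blast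
      hence "L r = q" using max[OF r] t by (simp add: fiber_def q_def)
      hence "r \<in> fiber m L q \<and> card r = p" using r bch by (auto simp: fiber_def)
      thus ?thesis by (simp add: c_def lookup_part)
    qed simp
  qed simp
  have "z = 0"
  proof (cases p)
    \<comment> \<open>Here no lower degree \<open>p'\<close> exists in which to place
      \<open>z\<close>; the only face is the empty one, with zero boundary.\<close>
    case 0
    have "diff c = 0"
    proof (rule poly_mapping_eqI, rule ccontr)
      fix t assume "Poly_Mapping.lookup (diff c) t \<noteq> Poly_Mapping.lookup 0 t"
      then obtain r i where "r \<in> Poly_Mapping.keys c" "i \<in> r" using diff_nonzeroD by fastforce
      moreover from this have "card r = 0" "finite r"
        using KQ_keysD[OF cK] 0 finite_subset[of r "{1..m}"] by auto
      ultimately show False by auto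
    qed
    thus ?thesis by (auto simp: z_def diffQ_def intro!: poly_mapping_eqI simp: lookup_projQ)
  next
    case (Suc p')
    have zb: "z \<in> boundariesQ m L q p'" using cK Suc by (simp add: z_def boundariesQ_def)
    have "z = part m L q p' (diff b)"
    proof (rule poly_mapping_eqI)
      fix t
      have "Poly_Mapping.lookup (diff b) t = 0" if "card t \<noteq> p'"
      proof (rule ccontr)
        assume "Poly_Mapping.lookup (diff b) t \<noteq> 0"
        then obtain r i where "r \<in> Poly_Mapping.keys b" "i \<in> r" "t = r - {i}"
          using diff_nonzeroD by blast
        thus False using that bch Suc by auto
      qed
      thus "Poly_Mapping.lookup z t = Poly_Mapping.lookup (part m L q p' (diff b)) t"
        using same[of t] by (auto simp: z_def diffQ_def lookup_projQ lookup_part)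
    qed
    then obtain h b' where hb: "z = h + b'" "h \<in> H q p'" "b' \<in> B' q p'"
      using span_HB'_parts[OF spl db q, of p'] by blast
    note sp' = splittingD[OF spl q, of p']
    \<comment> \<open>\<open>b'\<close> is a difference of cycles and lies in a complement of the
      cycles, so it vanishes; then \<open>z = h\<close> is a boundary in the complement
      \<open>H\<close> of the boundaries.\<close>
    have "z - h \<in> cyclesQ m L q p'"
      using zb hb(2) sp'(5,6) smul.subspace_diff[OF sp'(4)] by blast
    moreover have "z - h = b'" using hb by simp
    ultimately have "b' = 0" using hb(3) sp'(10) by auto
    hence "z = h" using hb by simp
    thus ?thesis using zb hb(2) sp'(9) by auto
  qed
  \<comment> \<open>Now \<open>c\<close> is a cycle in the complement \<open>B'\<close> of the
    cycles, although its coefficient at \<open>s\<close> is nonzero.\<close>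
  hence "c \<in> cyclesQ m L q p" using cK by (simp add: cyclesQ_def z_def)
  hence "c = 0" using cB sp(10) by blast
  thus False using \<open>c \<noteq> 0\<close> by blast
qed

lemma f_map_eq_0:
  fixes H B' :: "'r \<Rightarrow> nat \<Rightarrow> (nat set \<Rightarrow>\<^sub>0 'k::comm_ring_1) set"
  assumes spl: "splitting m L H B'"
    and da: "diff a \<in> smul.span (\<Union>q\<in>lcm_lattice m L. \<Union>j. H q j \<union> B' q j)"
  shows "f_map m L H B' p a = 0"
  unfolding f_map_def
proof (rule the_equality)
  show "0 \<in> smul.span (\<Union>q\<in>lcm_lattice m L. B' q p) \<and>
      diff (a + 0) \<in> smul.span (\<Union>q\<in>lcm_lattice m L. \<Union>j. H q j \<union> B' q j)"
    using da smul.span_zero by simp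
  fix b
  assume b: "b \<in> smul.span (\<Union>q\<in>lcm_lattice m L. B' q p) \<and>
      diff (a + b) \<in> smul.span (\<Union>q\<in>lcm_lattice m L. \<Union>j. H q j \<union> B' q j)"
  hence "diff (a + b) - diff a \<in> smul.span (\<Union>q\<in>lcm_lattice m L. \<Union>j. H q j \<union> B' q j)"
    using da smul.span_diff by blast
  hence "diff b \<in> smul.span (\<Union>q\<in>lcm_lattice m L. \<Union>j. H q j \<union> B' q j)"
    by (simp add: diff_add)
  thus "b = 0" using B'_chain_eq_0[OF spl] b by blast
qed

text \<open>Here \<open>K(q)\<close> is spanned by the single face \<open>s\<close>, and its
  differential vanishes because deleting an element leaves the fiber. So there are no nonzero
  boundaries, and every splitting has all of \<open>K(q)\<close> as its \<open>H\<close>.\<close>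

lemma H_scarf_face:
  fixes H B' :: "'r \<Rightarrow> nat \<Rightarrow> (nat set \<Rightarrow>\<^sub>0 'k::comm_ring_1) set"
  assumes spl: "splitting m L H B'" and s: "s \<in> scarf_faces m L"
  shows "H (L s) p = {c. Poly_Mapping.keys c \<subseteq> {t. t = s \<and> card t = p}}"
proof -
  let ?q = "L s"
  have q: "?q \<in> lcm_lattice m L" using s by (auto simp: lcm_lattice_def scarf_faces_def)
  have fib: "fiber m L ?q = {s}" by (rule scarf_face_fiber[OF s])
  have dz: "diffQ m L ?q c = 0" if "c \<in> KQ m L ?q j" for c :: "nat set \<Rightarrow>\<^sub>0 'k" and j
  proof (rule poly_mapping_eqI, rule ccontr)
    fix t assume "Poly_Mapping.lookup (diffQ m L ?q c) t \<noteq> Poly_Mapping.lookup 0 t"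
    hence t: "t = s" "Poly_Mapping.lookup (diff c) t \<noteq> 0"
      by (auto simp: diffQ_def lookup_projQ fib split: if_splits)
    then obtain r i where "r \<in> Poly_Mapping.keys c" "i \<in> r" "t = r - {i}"
      using diff_nonzeroD by blast
    thus False using t(1) that fib by (auto simp: KQ_iff)
  qed
  note sp = splittingD[OF spl q, of p]
  have "(boundariesQ m L ?q p :: (nat set \<Rightarrow>\<^sub>0 'k) set) \<subseteq> {0}"
    using dz[of _ "p + 1"] unfolding boundariesQ_def by blast
  hence "cyclesQ m L ?q p \<subseteq> H ?q p" unfolding sp(11) by auto
  hence "cyclesQ m L ?q p = H ?q p" using sp(5) by blast
  moreover have "(cyclesQ m L ?q p :: (nat set \<Rightarrow>\<^sub>0 'k) set) = KQ m L ?q p" using dz by (auto simp: cyclesQ_def)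
  ultimately have "H ?q p = KQ m L ?q p" by simp
  thus ?thesis by (auto simp: KQ_iff fib)
qed

lemma exact_KQ_iff_H_eq_0:
  fixes H B' :: "'r \<Rightarrow> nat \<Rightarrow> (nat set \<Rightarrow>\<^sub>0 'k::comm_ring_1) set"
  assumes spl: "splitting m L H B'" and q: "q \<in> lcm_lattice m L"
  shows "exact_KQ TYPE('k) m L q \<longleftrightarrow> (\<forall>p. H q p = {0})"
proof -
  have "(cyclesQ m L q p :: (nat set \<Rightarrow>\<^sub>0 'k) set) = boundariesQ m L q p \<longleftrightarrow> H q p = {0}" for p
  proof -
    note sp = splittingD[OF spl q, of p]
    show ?thesis
    proof
      assume "(cyclesQ m L q p :: (nat set \<Rightarrow>\<^sub>0 'k) set) = boundariesQ m L q p"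
      thus "H q p = {0}" using sp(5,9) by blast
    next
      assume "H q p = {0}"
      thus "(cyclesQ m L q p :: (nat set \<Rightarrow>\<^sub>0 'k) set) = boundariesQ m L q p" unfolding sp(11) by auto
    qed
  qed
  thus ?thesis unfolding exact_KQ_def by simp
qed

lemma f_map_scarf_face:
  fixes H B' :: "'r \<Rightarrow> nat \<Rightarrow> (nat set \<Rightarrow>\<^sub>0 'k::comm_ring_1) set"
  assumes spl: "splitting m L H B'" and s: "s \<in> scarf_faces m L" and a: "a \<in> H (L s) p"
  shows "f_map m L H B' p' a = 0"
proof (rule f_map_eq_0[OF spl])
  have ka: "Poly_Mapping.keys a \<subseteq> {s}" using a H_scarf_face[OF spl s] by auto
  let ?G = "\<Union>q\<in>lcm_lattice m L. \<Union>j. H q j \<union> B' q j"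
  have "smul (Poly_Mapping.lookup (diff a) t) (Poly_Mapping.single t 1) \<in> smul.span ?G"
    if t: "t \<in> Poly_Mapping.keys (diff a)" for t
  proof (rule smul.span_scale, rule smul.span_base)
    obtain i where "t = s - {i}"
      using diff_nonzeroD[of a t] t ka by (auto simp: in_keys_iff)
    hence ts: "t \<in> scarf_faces m L" using scarf_face_subset[OF s] by blast
    hence "Poly_Mapping.single t 1 \<in> H (L t) (card t)"
      unfolding H_scarf_face[OF spl ts] by auto
    thus "Poly_Mapping.single t 1 \<in> ?G" using ts by (auto simp: lcm_lattice_def scarf_faces_def)
  qed
  hence "(\<Sum>t\<in>Poly_Mapping.keys (diff a). smul (Poly_Mapping.lookup (diff a) t) (Poly_Mapping.single t 1))
      \<in> smul.span ?G"
    by (rule smul.span_sum)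
  thus "diff a \<in> smul.span ?G" by (simp flip: smul_sum_single)
qed

end

section \<open>Lifts and acyclicity\<close>

lemma const_poly_zero: "const_poly 0 = 0"
  by (simp add: const_poly_def)

lemma lookup_embed:
  fixes c :: "nat set \<Rightarrow>\<^sub>0 'k::comm_ring_1"
  shows "Poly_Mapping.lookup (embed c) s = const_poly (Poly_Mapping.lookup c s)"
  by (simp add: embed_def Poly_Mapping.map.rep_eq when_def const_poly_def)

lemma lookup_times_const_poly:
  fixes p :: "('x, 'k::comm_ring_1) mpoly"
  shows "Poly_Mapping.lookup (p * const_poly k) u = Poly_Mapping.lookup p u * k"
  using lookup_single_times[of 0 k p u] by (simp add: const_poly_def mult.commute)

lemma const_poly_add: "const_poly (a + b) = const_poly a + const_poly (b :: 'k::comm_ring_1)"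
  by (simp add: const_poly_def single_add)

lemma const_poly_sum: "const_poly (sum g J) = (\<Sum>j\<in>J. const_poly (g j :: 'k::comm_ring_1))"
  by (induction J rule: infinite_finite_induct) (simp_all add: const_poly_add, simp_all add: const_poly_def)

lemma const_poly_sign:
  "const_poly ((- 1) ^ n :: 'k::comm_ring_1) = ((- 1) ^ n :: ('x, 'k) mpoly)"
  by (induction n) (simp_all add: const_poly_def single_uminus)

lemma const_poly_eq_0_iff: "const_poly a = 0 \<longleftrightarrow> a = (0 :: 'k::comm_ring_1)"
  unfolding const_poly_def by (metis lookup_single_eq lookup_zero single_zero)

lemma lookup_diff_basis_const_poly:
  "(Poly_Mapping.lookup (diff_basis s) t :: ('x, 'k::comm_ring_1) mpoly) =
     const_poly (Poly_Mapping.lookup (diff_basis s) t)"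
  unfolding diff_basis_def lookup_sum const_poly_sum
proof (rule sum.cong)
  fix i assume "i \<in> s"
  show "(Poly_Mapping.lookup (Poly_Mapping.single (s - {i}) ((- 1) ^ eps s i)) t :: ('x, 'k) mpoly) =
      const_poly (Poly_Mapping.lookup (Poly_Mapping.single (s - {i}) ((- 1) ^ eps s i)) t)"
    by (cases "s - {i} = t") (simp_all add: const_poly_sign lookup_single const_poly_zero)
qed simp

lemma quot_self: "q \<noteq> 0 \<Longrightarrow> quot q q = (1 :: 'a::idom)"
  unfolding quot_def by (rule the_equality) auto

text \<open>Slices at the monomials express \<open>K(Q) \<otimes> S\<close> as a sum of copies of \<open>K(Q)\<close>.\<close>

definition slice :: "('x \<Rightarrow>\<^sub>0 nat) \<Rightarrow> (nat set \<Rightarrow>\<^sub>0 ('x, 'k::comm_ring_1) mpoly) \<Rightarrow> (nat set \<Rightarrow>\<^sub>0 'k)" where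
  "slice u c = Poly_Mapping.map (\<lambda>p. Poly_Mapping.lookup p u) c"

lemma lookup_slice: "Poly_Mapping.lookup (slice u c) s = Poly_Mapping.lookup (Poly_Mapping.lookup c s) u"
  by (simp add: slice_def Poly_Mapping.map.rep_eq when_def)

lemma keys_slice: "Poly_Mapping.keys (slice u c) \<subseteq> Poly_Mapping.keys c"
  by (auto simp: in_keys_iff lookup_slice)

text \<open>Inside one fiber every quotient of labels is \<open>quot q q = 1\<close>, so the Taylor
  differential has constant entries there and commutes with taking the coefficient of the monomial
  \<open>u\<close>.\<close>

lemma slice_taylor_diff:
  fixes c :: "nat set \<Rightarrow>\<^sub>0 ('x::linorder, 'k::idom) mpoly"
  assumes "Poly_Mapping.keys c \<subseteq> fiber m L q" "t \<in> fiber m L q" "q \<noteq> 0"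
  shows "Poly_Mapping.lookup (Poly_Mapping.lookup (taylor_diff L c) t) u =
    Poly_Mapping.lookup (diff (slice u c)) t"
proof -
  have "Poly_Mapping.lookup (Poly_Mapping.lookup (taylor_diff L c) t) u =
      (\<Sum>s\<in>Poly_Mapping.keys c. Poly_Mapping.lookup
        (Poly_Mapping.lookup c s * Poly_Mapping.lookup (taylor_diff_basis L s) t) u)"
    unfolding lookup_taylor_diff[OF finite_keys order_refl] by (simp only: lookup_sum)
  also have "\<dots> = (\<Sum>s\<in>Poly_Mapping.keys c.
      Poly_Mapping.lookup (slice u c) s * Poly_Mapping.lookup (diff_basis s) t)"
  proof (rule sum.cong)
    fix s assume "s \<in> Poly_Mapping.keys c"
    hence "L s = q" "L t = q" using assms by (auto simp: fiber_def)
    thus "Poly_Mapping.lookup (Poly_Mapping.lookup c s * Poly_Mapping.lookup (taylor_diff_basis L s) t) u =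
        Poly_Mapping.lookup (slice u c) s * Poly_Mapping.lookup (diff_basis s) t"
      by (simp add: lookup_taylor_diff_basis quot_self[OF assms(3)] lookup_slice
          lookup_diff_basis_const_poly lookup_times_const_poly)
  qed simp
  also have "\<dots> = Poly_Mapping.lookup (diff (slice u c)) t"
    by (rule lookup_diff[symmetric]) (simp_all add: keys_slice)
  finally show ?thesis .
qed

text \<open>Each slice of \<open>c\<close> is a cycle of \<open>K(q)\<close>, hence a boundary;
  preimages of the slices, multiplied by their monomials and added up, give \<open>g\<close>. The
  differential of \<open>g\<close> is controlled on the fiber of \<open>q\<close> only.\<close>

lemma exact_KQ_extend:
  fixes c :: "nat set \<Rightarrow>\<^sub>0 ('x::linorder, 'k::idom) mpoly"
  assumes ex: "exact_KQ TYPE('k) m L q" and q: "q \<noteq> 0"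
    and c: "c \<in> KQ m L q j"
    and dc: "\<And>t. t \<in> fiber m L q \<Longrightarrow> Poly_Mapping.lookup (taylor_diff L c) t = 0"
  shows "\<exists>g\<in>KQ m L q (j + 1). \<forall>t\<in>fiber m L q.
    Poly_Mapping.lookup (taylor_diff L g) t = Poly_Mapping.lookup c t"
proof -
  have cf: "Poly_Mapping.keys c \<subseteq> fiber m L q" using c by (auto simp: KQ_iff)
  have "\<exists>g. g \<in> KQ m L q (j + 1) \<and> diffQ m L q g = slice u c" for u
  proof -
    have "slice u c \<in> KQ m L q j" using c keys_slice[of u c] unfolding KQ_iff by blast
    moreover have "diffQ m L q (slice u c) = 0"
      by (rule poly_mapping_eqI)
        (simp add: diffQ_def lookup_projQ dc flip: slice_taylor_diff[OF cf _ q])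
    ultimately have "slice u c \<in> cyclesQ m L q j" by (simp add: cyclesQ_def)
    also have "\<dots> = boundariesQ m L q j" using ex by (simp add: exact_KQ_def)
    finally show ?thesis unfolding boundariesQ_def by force
  qed
  then obtain g where g: "\<And>u. g u \<in> KQ m L q (j + 1)" "\<And>u. diffQ m L q (g u) = slice u c"
    by metis
  \<comment> \<open>Preimages were chosen for all monomials, but the sum must be finite; outside
    \<open>U\<close> the slices of \<open>c\<close> vanish.\<close>
  define U where "U = (\<Union>s\<in>Poly_Mapping.keys c. Poly_Mapping.keys (Poly_Mapping.lookup c s))"
  have "finite U" by (simp add: U_def)
  define G where "G = (\<Sum>u\<in>U. smul (Poly_Mapping.single u 1) (embed (g u)))"
  have lG: "Poly_Mapping.lookup G s = (\<Sum>u\<in>U. Poly_Mapping.single u (Poly_Mapping.lookup (g u) s))" for s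
    by (simp add: G_def lookup_sum lookup_smul lookup_embed const_poly_def mult_single)
  have GK: "G \<in> KQ m L q (j + 1)"
    unfolding KQ_iff
  proof
    fix s assume "s \<in> Poly_Mapping.keys G"
    hence "(\<Sum>u\<in>U. Poly_Mapping.single u (Poly_Mapping.lookup (g u) s)) \<noteq> 0"
      by (simp add: in_keys_iff lG)
    then obtain u where "Poly_Mapping.single u (Poly_Mapping.lookup (g u) s) \<noteq> 0"
      by (rule sum.not_neutral_contains_not_neutral)
    hence "s \<in> Poly_Mapping.keys (g u)" by (auto simp: in_keys_iff)
    thus "s \<in> {s \<in> fiber m L q. card s = j + 1}" using g(1)[of u] unfolding KQ_iff by blast
  qed
  have slG: "slice u G = (if u \<in> U then g u else 0)" for u
    by (rule poly_mapping_eqI)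
      (simp add: lookup_slice lG lookup_sum lookup_single when_def sum.delta[OF \<open>finite U\<close>])
  have Gf: "Poly_Mapping.keys G \<subseteq> fiber m L q" using GK by (auto simp: KQ_iff)
  have "Poly_Mapping.lookup (taylor_diff L G) t = Poly_Mapping.lookup c t" if t: "t \<in> fiber m L q" for t
  proof (rule poly_mapping_eqI)
    fix u
    have "Poly_Mapping.lookup (Poly_Mapping.lookup (taylor_diff L G) t) u =
        Poly_Mapping.lookup (diff (slice u G)) t"
      by (rule slice_taylor_diff[OF Gf t q])
    also have "\<dots> = Poly_Mapping.lookup (Poly_Mapping.lookup c t) u"
    proof (cases "u \<in> U")
      case True
      have "Poly_Mapping.lookup (diff (g u)) t = Poly_Mapping.lookup (diffQ m L q (g u)) t"
        using t by (simp add: diffQ_def lookup_projQ)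
      thus ?thesis using True g(2) by (simp add: slG lookup_slice)
    next
      case False
      hence "Poly_Mapping.lookup (Poly_Mapping.lookup c t) u = 0"
        by (cases "t \<in> Poly_Mapping.keys c") (auto simp: U_def in_keys_iff)
      thus ?thesis using False by (simp add: slG diff_def)
    qed
    finally show "Poly_Mapping.lookup (Poly_Mapping.lookup (taylor_diff L G) t) u =
        Poly_Mapping.lookup (Poly_Mapping.lookup c t) u" .
  qed
  thus ?thesis using GK by blast
qed

section \<open>The Scarf complex inside the Taylor complex\<close>

locale mpoly_lcm_family = lcm_family m Q L
  for m :: nat and Q :: "nat \<Rightarrow> ('x::{finite,linorder}, 'k::field) mpoly" and L
begin

lemma taylor_diff_scarf:
  assumes "Poly_Mapping.keys c \<subseteq> scarf_faces m L"
  shows "Poly_Mapping.keys (taylor_diff L c) \<subseteq> scarf_faces m L"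
proof
  fix t assume "t \<in> Poly_Mapping.keys (taylor_diff L c)"
  then obtain s i where "s \<in> Poly_Mapping.keys c" "t = s - {i}"
    using taylor_diff_nonzeroD[of L c t] by (auto simp: in_keys_iff)
  thus "t \<in> scarf_faces m L" using assms scarf_face_subset by blast
qed

text \<open>Subtracting a boundary clears the fiber of \<open>q\<close> but may add non-Scarf faces
  below it, so the support need not shrink. The measure counts the lattice elements that divide the
  label of some remaining non-Scarf face: new labels divide \<open>q\<close>, and \<open>q\<close>
  itself drops out.\<close>

lemma move_into_scarf:
  assumes ex: "\<And>q. q \<in> lcm_lattice m L \<Longrightarrow> card (fiber m L q) = 1 \<or> exact_KQ TYPE('k) m L q"
    and dd: "\<And>g. g \<in> chains m (p + 2) \<Longrightarrow>
      taylor_diff L g \<in> chains m (p + 1) \<and> taylor_diff L (taylor_diff L g) = 0"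
    and "e \<in> chains m (p + 1)" "Poly_Mapping.keys (taylor_diff L e) \<subseteq> scarf_faces m L"
  shows "\<exists>e'\<in>chains m (p + 1). Poly_Mapping.keys e' \<subseteq> scarf_faces m L \<and> taylor_diff L e' = taylor_diff L e"
  using assms(3,4)
proof (induction "card {r \<in> lcm_lattice m L. \<exists>s\<in>Poly_Mapping.keys e - scarf_faces m L. r dvd L s}"
    arbitrary: e rule: less_induct)
  case less
  define N where "N = Poly_Mapping.keys e - scarf_faces m L"
  have e: "Poly_Mapping.keys e \<subseteq> {s. s \<subseteq> {1..m} \<and> card s = p + 1}"
    using less.prems by (simp add: chains_def)
  show ?case
  proof (cases "N = {}")
    case True
    thus ?thesis using less.prems by (intro bexI[of _ e]) (auto simp: N_def)
  next
    case False
    obtain s where s: "s \<in> N" and max: "\<And>t. t \<in> N \<Longrightarrow> L s dvd L t \<Longrightarrow> L t = L s"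
      by (rule keys_maximal_label[of N]) (use False e in \<open>auto simp: N_def\<close>)
    define q where "q = L s"
    have sm: "s \<subseteq> {1..m}" using s e by (auto simp: N_def)
    have q: "q \<in> lcm_lattice m L" "q \<noteq> 0" using sm lcm_nonzero by (auto simp: q_def lcm_lattice_def)
    have nonscarf: "t \<notin> scarf_faces m L" if "t \<in> fiber m L q" for t
      using that s sm by (auto simp: fiber_def scarf_faces_def q_def N_def)
    have "card (fiber m L q) \<noteq> 1" using s sm by (auto simp: N_def scarf_faces_def q_def)
    hence exq: "exact_KQ TYPE('k) m L q" using ex q by blast
    define c where "c = part m L q (p + 1) e"
    have cK: "c \<in> KQ m L q (p + 1)"
      unfolding KQ_iff by (auto simp: c_def in_keys_iff lookup_part split: if_splits)
    have ce: "Poly_Mapping.lookup c t = Poly_Mapping.lookup e t" if "t \<in> fiber m L q" for t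
      using that e by (cases "t \<in> Poly_Mapping.keys e") (auto simp: c_def lookup_part in_keys_iff)
    have kc: "Poly_Mapping.keys c \<subseteq> Poly_Mapping.keys e"
      by (auto simp: c_def in_keys_iff lookup_part split: if_splits)
    have "Poly_Mapping.lookup (taylor_diff L c) t = 0" if t: "t \<in> fiber m L q" for t
    proof -
      have "Poly_Mapping.lookup (taylor_diff L c) t = Poly_Mapping.lookup (taylor_diff L e) t"
        unfolding lookup_taylor_diff[OF finite_keys kc]
          lookup_taylor_diff[OF finite_keys order_refl[of "Poly_Mapping.keys e"]]
      proof (rule sum.cong)
        fix r assume r: "r \<in> Poly_Mapping.keys e"
        show "Poly_Mapping.lookup c r * Poly_Mapping.lookup (taylor_diff_basis L r) t =
            Poly_Mapping.lookup e r * Poly_Mapping.lookup (taylor_diff_basis L r) t"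
        proof (cases "Poly_Mapping.lookup (diff_basis r) t = (0 :: ('x, 'k) mpoly)")
          case False
          then obtain i where i: "i \<in> r" "t = r - {i}" using diff_basis_nonzeroD by blast
          \<comment> \<open>Subsets of Scarf faces are Scarf, so \<open>r\<close>, which contains
            the non-Scarf \<open>t\<close>, is not; hence the maximality of \<open>q\<close> applies
            to its label.\<close>
          hence "r \<in> N" using r scarf_face_subset nonscarf[OF t] by (auto simp: N_def)
          moreover have "L t dvd L r" using lcm_mono[of r t] r e i by blast
          hence "L s dvd L r" using t by (simp add: fiber_def q_def)
          ultimately have "L r = q" using max by (simp add: q_def)
          hence "r \<in> fiber m L q" using r e by (auto simp: fiber_def)
          thus ?thesis by (simp add: ce)
        qed (simp add: lookup_taylor_diff_basis)
      qed simp
      \<comment> \<open>The boundary of \<open>e\<close> is supported on Scarf faces, and none of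
        them lies in this fiber.\<close>
      also have "\<dots> = 0"
        using nonscarf[OF t] less.prems(2) by (auto simp: in_keys_iff subset_iff)
      finally show ?thesis .
    qed
    then obtain g where g: "g \<in> KQ m L q (p + 1 + 1)"
      and gc: "\<And>t. t \<in> fiber m L q \<Longrightarrow> Poly_Mapping.lookup (taylor_diff L g) t = Poly_Mapping.lookup c t"
      using exact_KQ_extend[OF exq q(2) cK] by blast
    have dg: "taylor_diff L g \<in> chains m (p + 1)" "taylor_diff L (taylor_diff L g) = 0"
      using dd[of g] g by (simp_all add: KQ_def)
    have dg_dvd: "L t dvd q" if "t \<in> Poly_Mapping.keys (taylor_diff L g)" for t
    proof -
      have "Poly_Mapping.lookup (taylor_diff L g) t \<noteq> 0" using that by (simp add: in_keys_iff)
      from taylor_diff_nonzeroD[OF this] obtain r i where r: "r \<in> Poly_Mapping.keys g" "t = r - {i}"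
        by blast
      hence "L r = q" "r \<subseteq> {1..m}" using KQ_keysD[OF g] by (auto simp: fiber_def)
      thus ?thesis using lcm_mono[of r t] r by auto
    qed
    define e' where "e' = e - taylor_diff L g"
    have ke': "Poly_Mapping.keys e' \<subseteq> Poly_Mapping.keys e \<union> Poly_Mapping.keys (taylor_diff L g)"
      unfolding e'_def by (rule keys_diff)
    have e'ch: "e' \<in> chains m (p + 1)"
      using ke' less.prems(1) dg(1) unfolding chains_def by blast
    have de': "taylor_diff L e' = taylor_diff L e"
      by (simp add: e'_def taylor_diff_minus dg)
    have e'q: "t \<notin> Poly_Mapping.keys e'" if "t \<in> fiber m L q" for t
      using that by (simp add: e'_def in_keys_iff lookup_minus gc ce)
    let ?D = "\<lambda>e. {r \<in> lcm_lattice m L. \<exists>s\<in>Poly_Mapping.keys e - scarf_faces m L. r dvd L s}"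
    have "?D e' \<subseteq> ?D e"
    proof
      fix r assume "r \<in> ?D e'"
      then obtain t where t: "r \<in> lcm_lattice m L" "t \<in> Poly_Mapping.keys e'" "t \<notin> scarf_faces m L" "r dvd L t"
        by blast
      show "r \<in> ?D e"
      proof (cases "t \<in> Poly_Mapping.keys e")
        case True
        thus ?thesis using t by blast
      next
        case False
        hence "L t dvd L s" using t ke' dg_dvd by (auto simp: q_def)
        hence "r dvd L s" using t(4) dvd_trans by blast
        thus ?thesis using s t(1) by (auto simp: N_def)
      qed
    qed
    moreover have "q \<in> ?D e"
    proof -
      have "s \<in> Poly_Mapping.keys e - scarf_faces m L" "q dvd L s" using s by (simp_all add: N_def q_def)
      thus ?thesis using q(1) by blast
    qed
    moreover have "q \<notin> ?D e'"
    proof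
      assume "q \<in> ?D e'"
      then obtain t where t: "t \<in> Poly_Mapping.keys e'" "t \<notin> scarf_faces m L" "q dvd L t"
        by blast
      have tm: "t \<subseteq> {1..m}" using t(1) e'ch by (auto simp: chains_def)
      \<comment> \<open>For a face already in \<open>e\<close> this is maximality; a new face has a
        label dividing \<open>q\<close>, so the two labels divide each other. Either way
        \<open>t\<close> lies in the cleared fiber.\<close>
      have "L t = q"
      proof (cases "t \<in> Poly_Mapping.keys e")
        case True
        thus ?thesis using t max[of t] by (auto simp: q_def N_def)
      next
        case False
        hence "L t dvd L s" using t ke' dg_dvd by (auto simp: q_def)
        thus ?thesis using t(3) lcm_antisym[OF tm sm] by (simp add: q_def)
      qed
      thus False using e'q[of t] t(1) tm by (simp add: fiber_def)
    qed
    ultimately have "?D e' \<subset> ?D e" by blast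
    moreover have "finite (?D e)" by (simp add: lcm_lattice_def)
    ultimately have "card (?D e') < card (?D e)" by (rule psubset_card_mono[rotated])
    from less.hyps[OF this e'ch] show ?thesis using less.prems(2) de' by simp
  qed
qed

lemma acyclic_scarf:
  assumes ex: "\<And>q. q \<in> lcm_lattice m L \<Longrightarrow> card (fiber m L q) = 1 \<or> exact_KQ TYPE('k) m L q"
    and taylor: "acyclic_subcomplex m L UNIV"
  shows "acyclic_subcomplex m L (scarf_complex m L)"
  unfolding acyclic_subcomplex_def
proof (intro allI impI)
  fix p :: nat assume p: "p \<ge> 1"
  have T: "{c \<in> chains m j. taylor_diff L c = 0} = taylor_diff L ` chains m (j + 1)" if "j \<ge> 1" for j
    using taylor that unfolding acyclic_subcomplex_def by simp
  \<comment> \<open>Both facts are the inclusion of images in cycles contained in the assumed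
    acyclicity in degree \<open>p + 1\<close>, so no sign computation occurs.\<close>
  have dd: "taylor_diff L g \<in> chains m (p + 1) \<and> taylor_diff L (taylor_diff L g) = 0"
    if "g \<in> chains m (p + 2)" for g
    using T[of "p + 1"] that by (auto simp: set_eq_iff)
  show "{c \<in> scarf_complex m L \<inter> chains m p. taylor_diff L c = 0} =
      taylor_diff L ` (scarf_complex m L \<inter> chains m (p + 1))"
  proof (intro equalityI subsetI)
    fix c assume "c \<in> {c \<in> scarf_complex m L \<inter> chains m p. taylor_diff L c = 0}"
    hence c: "c \<in> scarf_complex m L" "c \<in> {c \<in> chains m p. taylor_diff L c = 0}" by auto
    then obtain e where e: "e \<in> chains m (p + 1)" "c = taylor_diff L e" unfolding T[OF p] by blast
    have "Poly_Mapping.keys (taylor_diff L e) \<subseteq> scarf_faces m L"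
      using c(1) e(2) by (simp add: scarf_complex_iff)
    from move_into_scarf[OF ex dd e(1) this]
    obtain e' where "e' \<in> chains m (p + 1)" "Poly_Mapping.keys e' \<subseteq> scarf_faces m L" "c = taylor_diff L e'"
      using e(2) by auto
    thus "c \<in> taylor_diff L ` (scarf_complex m L \<inter> chains m (p + 1))"
      by (auto simp: scarf_complex_iff)
  next
    fix c assume "c \<in> taylor_diff L ` (scarf_complex m L \<inter> chains m (p + 1))"
    then obtain e where e: "e \<in> scarf_complex m L" "e \<in> chains m (p + 1)" "c = taylor_diff L e"
      by blast
    have "c \<in> taylor_diff L ` chains m (p + 1)" using e by blast
    hence "c \<in> chains m p \<and> taylor_diff L c = 0" unfolding T[OF p, symmetric] by blast
    moreover have "c \<in> scarf_complex m L"
      using e taylor_diff_scarf by (simp add: scarf_complex_iff)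
    ultimately show "c \<in> {c \<in> scarf_complex m L \<inter> chains m p. taylor_diff L c = 0}" by blast
  qed
qed

text \<open>Each correction term is supported on the fiber of a proper divisor of \<open>q\<close>,
  which is disjoint from the fiber of \<open>q\<close>, whatever value \<open>f_map\<close>
  has.\<close>

lemma lookup_lift:
  assumes "s \<in> fiber m L q"
  shows "Poly_Mapping.lookup (lift m L H B' q p a) s = const_poly (Poly_Mapping.lookup a s)"
proof -
  have "(\<Sum>r\<in>{r \<in> lcm_lattice m L. proper_dvd r q}. Poly_Mapping.lookup
      (smul (quot q r) (embed (projQ m L r (f_map m L H B' p a)))) s) = 0"
  proof (rule sum.neutral, intro ballI)
    fix r assume "r \<in> {r \<in> lcm_lattice m L. proper_dvd r q}"
    hence "s \<notin> fiber m L r" using assms by (auto simp: fiber_def proper_dvd_def)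
    thus "Poly_Mapping.lookup (smul (quot q r) (embed (projQ m L r (f_map m L H B' p a)))) s = 0"
      by (simp add: lookup_smul lookup_embed lookup_projQ const_poly_zero)
  qed
  thus ?thesis by (simp add: lift_def lookup_add lookup_sum lookup_embed)
qed

lemma lift_eq_embed:
  assumes "f_map m L H B' p a = 0"
  shows "lift m L H B' q p a = embed a"
proof -
  have "smul x (embed (projQ m L r (f_map m L H B' p a))) = 0" for x :: "('x, 'k) mpoly" and r
    by (rule poly_mapping_eqI) (simp add: assms lookup_smul lookup_embed lookup_projQ const_poly_zero)
  thus ?thesis by (simp add: lift_def)
qed

lemma M_complex_eq_scarf_imp:
  assumes spl: "splitting m L H B'" and M: "M_complex m L H B' = scarf_complex m L"
    and q: "q \<in> lcm_lattice m L"
  shows "card (fiber m L q) = 1 \<or> exact_KQ TYPE('k) m L q"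
proof (cases "\<forall>p. H q p = {0}")
  case True
  thus ?thesis using exact_KQ_iff_H_eq_0[OF spl q] by blast
next
  case False
  then obtain p where "H q p \<noteq> {0}" by blast
  moreover have "0 \<in> H q p" by (rule smul.subspace_0[OF splittingD(1)[OF spl q]])
  ultimately obtain a where a: "a \<in> H q p" "a \<noteq> 0" by blast
  then obtain s where s: "s \<in> Poly_Mapping.keys a" by (metis keys_eq_empty ex_in_conv)
  have aK: "a \<in> KQ m L q p" using a splittingD(5,7)[OF spl q, of p] by blast
  hence sq: "s \<in> fiber m L q" using KQ_keysD[OF aK s] by blast
  have "lift m L H B' q p a \<in> M_complex m L H B'"
    unfolding M_complex_def using q a by (intro smul.span_base) blast
  hence "Poly_Mapping.keys (lift m L H B' q p a) \<subseteq> scarf_faces m L"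
    by (simp add: M scarf_complex_iff)
  moreover have "s \<in> Poly_Mapping.keys (lift m L H B' q p a)"
    using s by (simp add: in_keys_iff lookup_lift[OF sq] const_poly_eq_0_iff)
  ultimately have "s \<in> scarf_faces m L" by blast
  thus ?thesis using sq by (auto simp: scarf_faces_def fiber_def)
qed

lemma M_complex_eq_scarf:
  assumes spl: "splitting m L H B'"
    and ex: "\<And>q. q \<in> lcm_lattice m L \<Longrightarrow> card (fiber m L q) = 1 \<or> exact_KQ TYPE('k) m L q"
  shows "M_complex m L H B' = scarf_complex m L"
proof
  have "lift m L H B' q p a \<in> scarf_complex m L" if q: "q \<in> lcm_lattice m L" and a: "a \<in> H q p" for q p a
  proof (cases "card (fiber m L q) = 1")
    case True
    obtain s where s: "s \<subseteq> {1..m}" "q = L s" using q by (auto simp: lcm_lattice_def)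
    hence sf: "s \<in> scarf_faces m L" using True by (simp add: scarf_faces_def)
    have "f_map m L H B' p a = 0" using f_map_scarf_face[OF spl sf] a s by simp
    hence l: "lift m L H B' q p a = embed a" by (rule lift_eq_embed)
    have "Poly_Mapping.keys a \<subseteq> {s}" using a H_scarf_face[OF spl sf, of p] s by auto
    hence "Poly_Mapping.keys (embed a) \<subseteq> {s}"
      by (auto simp: in_keys_iff lookup_embed const_poly_eq_0_iff subset_iff)
    thus ?thesis using sf by (auto simp: l scarf_complex_iff)
  next
    case False
    \<comment> \<open>Exactness makes \<open>H q p\<close> zero; as \<open>f\<close> sends 0 to 0,
      the only lift in this degree is 0.\<close>
    hence "a = 0" using ex[OF q] exact_KQ_iff_H_eq_0[OF spl q] a by auto
    moreover have "diff (0 :: nat set \<Rightarrow>\<^sub>0 'k) = 0" by (simp add: diff_def)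
    ultimately have "f_map m L H B' p a = 0"
      using smul.span_zero by (intro f_map_eq_0[OF spl]) simp
    hence "lift m L H B' q p a = embed a" by (rule lift_eq_embed)
    also have "\<dots> = 0"
      using \<open>a = 0\<close> by (intro poly_mapping_eqI) (simp add: lookup_embed const_poly_zero)
    finally show ?thesis by (simp add: scarf_complex_iff)
  qed
  thus "M_complex m L H B' \<subseteq> scarf_complex m L"
    unfolding M_complex_def
    by (intro smul.span_minimal) (auto simp: scarf_complex_def)
next
  have "Poly_Mapping.single s 1 \<in> M_complex m L H B'" if s: "s \<in> scarf_faces m L" for s
  proof -
    let ?a = "Poly_Mapping.single s 1 :: nat set \<Rightarrow>\<^sub>0 'k"
    have a: "?a \<in> H (L s) (card s)" unfolding H_scarf_face[OF spl s] by auto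
    have "lift m L H B' (L s) (card s) ?a = embed ?a"
      by (rule lift_eq_embed[OF f_map_scarf_face[OF spl s a]])
    also have "\<dots> = Poly_Mapping.single s 1"
      by (rule poly_mapping_eqI) (simp add: lookup_embed lookup_single when_def const_poly_def)
    finally have "Poly_Mapping.single s 1 = lift m L H B' (L s) (card s) ?a" ..
    moreover have "L s \<in> lcm_lattice m L" using s by (auto simp: scarf_faces_def lcm_lattice_def)
    ultimately show ?thesis
      unfolding M_complex_def using a by (intro smul.span_base) blast
  qed
  thus "scarf_complex m L \<subseteq> M_complex m L H B'"
    unfolding scarf_complex_def M_complex_def
    by (intro smul.span_minimal) (auto simp: scarf_faces_def)
qed

end

theorem proposition4p4:
  fixes m :: nat
    and Q :: "nat \<Rightarrow> ('x::{finite,linorder}, 'k::field) mpoly"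
    and I :: "('x, 'k) mpoly set"
    and R :: "('x, 'k) mpoly set"
    and L :: "nat set \<Rightarrow> ('x, 'k) mpoly"
    and H B' :: "('x, 'k) mpoly \<Rightarrow> nat \<Rightarrow> (nat set \<Rightarrow>\<^sub>0 'k) set"
  assumes "inj_on Q {1..m}"
    and "\<And>i. i \<in> {1..m} \<Longrightarrow> homogeneous (Q i) \<and> (\<forall>c. Q i \<noteq> const_poly c)"
    and "minimally_generates (Q ` {1..m}) I"
    and "irreducible_factor_reps (Q ` {1..m}) R"
    and "\<And>s. s \<subseteq> {1..m} \<Longrightarrow> normalized_lcm R (Q ` s) (L s)"
    and "splitting m L H B'"
    and "taylor_is_resolution m L I"
  shows "(M_complex m L H B' = scarf_complex m L \<longleftrightarrow>
            (\<forall>q\<in>lcm_lattice m L. card (fiber m L q) = 1 \<or> exact_KQ TYPE('k) m L q)) \<and>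
         (M_complex m L H B' = scarf_complex m L \<longrightarrow>
            acyclic_subcomplex m L (scarf_complex m L))"
proof -
  interpret mpoly_lcm_family m Q L
  proof
    show "L s dvd q \<longleftrightarrow> (\<forall>i\<in>s. Q i dvd q)" if "s \<subseteq> {1..m}" for s q
    proof -
      have "\<forall>i\<in>s. Q i dvd L s" "(\<forall>i\<in>s. Q i dvd q) \<Longrightarrow> L s dvd q"
        using assms(5)[OF that] unfolding normalized_lcm_def by blast+
      thus ?thesis using dvd_trans by blast
    qed
    show "L s = L t" if "s \<subseteq> {1..m}" "t \<subseteq> {1..m}" "L s dvd L t" "L t dvd L s" for s t
      using normalized_lcm_unique[OF assms(4) assms(5)[OF that(1)] assms(5)[OF that(2)] that(3,4)] .
    show "L s \<noteq> 0" if "s \<subseteq> {1..m}" for s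
      by (rule normalized_lcm_nonzero[OF assms(4) assms(5)[OF that]])
  qed
  have taylor: "acyclic_subcomplex m L UNIV"
    using assms(7) by (simp add: taylor_is_resolution_def)
  show ?thesis
  proof (intro conjI iffI impI)
    assume M: "M_complex m L H B' = scarf_complex m L"
    note ex = M_complex_eq_scarf_imp[OF assms(6) M]
    show "\<forall>q\<in>lcm_lattice m L. card (fiber m L q) = 1 \<or> exact_KQ TYPE('k) m L q"
      by (intro ballI ex)
    show "acyclic_subcomplex m L (scarf_complex m L)"
      by (rule acyclic_scarf[OF ex taylor])
  next
    assume "\<forall>q\<in>lcm_lattice m L. card (fiber m L q) = 1 \<or> exact_KQ TYPE('k) m L q"
    thus "M_complex m L H B' = scarf_complex m L"
      by (intro M_complex_eq_scarf[OF assms(6)]) (rule bspec)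
  qed
qed

end
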